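(* There is an algorithm that, given a chordal graph $G$ of order $n$, enumerates all minimal Roman dominating functions of $G$ with polynomial delay, using polynomial space, in total time $\mathcal{O}(1.8940^n)$.
   Context: All graphs are finite, undirected and simple. A graph is chordal if it contains no induced cycle of length at least four. For a graph $G=(V,E)$, a function $f\colon V\to\{0,1,2\}$ is a Roman dominating function (rdf) if every vertex $v$ with $f(v)=0$ has a neighbor $u$ with $f(u)=2$. Functions $V\to\{0,1,2\}$ are ordered pointwise: $f\le g$ iff $f(v)\le g(v)$ for all $v$. An rdf $f$ is minimal if there is no rdf $g\neq f$ with $g\le f$. Polynomial delay means the time before the first output, between consecutive outputs, and after the last output is bounded by a polynomial in $n$. *)

theory Defs
  imports
    "Graph_Theory.Pair_Digraph"
    "HOL-Computational_Algebra.Polynomial"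
    "HOL-Library.FuncSet"
    "HOL-Library.Landau_Symbols"
begin

section \<open>Chordal graphs and minimal Roman dominating functions\<close>

text \<open>
  Finite simple undirected graphs are the \<^locale>\<open>pair_graph\<close>s of the library: finite, symmetric,
  loop-free digraphs whose arcs are ordered pairs, so that each edge gives two opposite arcs.
\<close>

definition induced_cycle :: "'a pair_pre_digraph \<Rightarrow> 'a list \<Rightarrow> bool" where
  "induced_cycle G c \<longleftrightarrow>
     3 \<le> length c \<and> distinct c \<and> set c \<subseteq> pverts G \<and>
     (\<forall>i < length c. \<forall>j < length c.
        (c ! i, c ! j) \<in> parcs G \<longleftrightarrow>
        j = Suc i mod length c \<or> i = Suc j mod length c)"

definition chordal :: "'a pair_pre_digraph \<Rightarrow> bool" where
  "chordal G \<longleftrightarrow> \<not> (\<exists>c. induced_cycle G c \<and> 4 \<le> length c)"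

text \<open>
  Functions on the vertex set are extensional, i.e. fixed to \<^const>\<open>undefined\<close> outside of it, so
  that equality of functions is equality on the vertices.
\<close>

definition rdf :: "'a pair_pre_digraph \<Rightarrow> ('a \<Rightarrow> nat) \<Rightarrow> bool" where
  "rdf G f \<longleftrightarrow>
     f \<in> pverts G \<rightarrow>\<^sub>E {0, 1, 2} \<and>
     (\<forall>v \<in> pverts G. f v = 0 \<longrightarrow> (\<exists>u \<in> pverts G. (v, u) \<in> parcs G \<and> f u = 2))"

definition minimal_rdf :: "'a pair_pre_digraph \<Rightarrow> ('a \<Rightarrow> nat) \<Rightarrow> bool" where
  "minimal_rdf G f \<longleftrightarrow>
     rdf G f \<and> \<not> (\<exists>g. rdf G g \<and> g \<noteq> f \<and> (\<forall>v \<in> pverts G. g v \<le> f v))"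


section \<open>Algorithms\<close>

text \<open>
  Algorithms are programs of a deterministic while language for a random access machine with a
  write-only output. The memory consists of arrays of natural numbers. Array names are literals
  in a program, so a program uses a fixed finite number of arrays; the indices are computed.
  \<open>Sub\<close> is truncated subtraction, and conditions hold if they evaluate to a non-zero number.

  Every command other than sequencing, and every test, takes one time step. This is realistic
  only if the numbers are small: below we require that all memory contents are bounded by a
  polynomial in the order of the input graph, i.e. have a word length of \<open>O(log n)\<close> bits. The
  expressions occurring in a program have a fixed size, hence so does the work done in one step.
\<close>

type_synonym mem = "nat \<Rightarrow> nat \<Rightarrow> nat"

datatype expr =
    Const nat
  | Read nat expr
  | Add expr expr
  | Sub expr expr
  | Mul expr expr

primrec val :: "expr \<Rightarrow> mem \<Rightarrow> nat" where
  "val (Const k) s = k"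
| "val (Read a e) s = s a (val e s)"
| "val (Add e e') s = val e s + val e' s"
| "val (Sub e e') s = val e s - val e' s"
| "val (Mul e e') s = val e s * val e' s"

datatype com =
    Skip
  | Write nat expr expr
  | Print expr
  | EndOutput
  | Seq com com
  | Cond expr com com
  | While expr com

definition store :: "nat \<Rightarrow> nat \<Rightarrow> nat \<Rightarrow> mem \<Rightarrow> mem" where
  "store a i k s = s(a := (s a)(i := k))"

text \<open>
  An output is a sequence of symbols that is printed one by one and completed by \<open>End\<close>.
\<close>

datatype event = Silent | Symbol nat | End

text \<open>
  \<open>exec c s tr s'\<close>: the program \<open>c\<close>, started in memory \<open>s\<close>, terminates in memory \<open>s'\<close>. The
  trace \<open>tr\<close> has one entry per time step, with the event and the memory after that step.
\<close>

inductive exec :: "com \<Rightarrow> mem \<Rightarrow> (event \<times> mem) list \<Rightarrow> mem \<Rightarrow> bool" where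
  Skip: "exec Skip s [(Silent, s)] s"
| Write: "s' = store a (val i s) (val e s) s \<Longrightarrow> exec (Write a i e) s [(Silent, s')] s'"
| Print: "exec (Print e) s [(Symbol (val e s), s)] s"
| EndOutput: "exec EndOutput s [(End, s)] s"
| Seq: "exec c s tr s' \<Longrightarrow> exec c' s' tr' s'' \<Longrightarrow> exec (Seq c c') s (tr @ tr') s''"
| CondTrue: "val b s \<noteq> 0 \<Longrightarrow> exec c s tr s' \<Longrightarrow> exec (Cond b c c') s ((Silent, s) # tr) s'"
| CondFalse: "val b s = 0 \<Longrightarrow> exec c' s tr s' \<Longrightarrow> exec (Cond b c c') s ((Silent, s) # tr) s'"
| WhileFalse: "val b s = 0 \<Longrightarrow> exec (While b c) s [(Silent, s)] s"
| WhileTrue: "val b s \<noteq> 0 \<Longrightarrow> exec c s tr s' \<Longrightarrow> exec (While b c) s' tr' s'' \<Longrightarrow>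
    exec (While b c) s ((Silent, s) # tr @ tr') s''"

lemma exec_deterministic:
  "exec c s tr s' \<Longrightarrow> exec c s tr' s'' \<Longrightarrow> tr' = tr \<and> s'' = s'"
proof (induction arbitrary: tr' s'' rule: exec.induct)
  case (Skip s)
  from Skip.prems show ?case by cases simp
next
  case (Write s' a i s e)
  from Write.prems show ?case by cases (simp add: Write.hyps)
next
  case (Print e s)
  from Print.prems show ?case by cases simp
next
  case (EndOutput s)
  from EndOutput.prems show ?case by cases simp
next
  case (Seq c s tr s' c' tr' s'')
  from Seq.prems show ?case by cases (blast dest: Seq.IH)
next
  case (CondTrue b s c tr s' c')
  from CondTrue.prems show ?case by cases (use CondTrue.hyps in \<open>auto dest: CondTrue.IH\<close>)
next
  case (CondFalse b s c' tr s' c)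
  from CondFalse.prems show ?case by cases (use CondFalse.hyps in \<open>auto dest: CondFalse.IH\<close>)
next
  case (WhileFalse b s c)
  from WhileFalse.prems show ?case by cases (use WhileFalse.hyps in auto)
next
  case (WhileTrue b s c tr s' tr' s'')
  from WhileTrue.prems show ?case
    by cases (use WhileTrue.hyps in \<open>auto dest: WhileTrue.IH\<close>)
qed

text \<open>
  The input graph has vertices \<open>0, \<dots>, n - 1\<close>. Array 0 holds \<open>n\<close> and array 1 the adjacency
  matrix, row by row. All other cells are 0.
\<close>

definition graph_input :: "nat \<Rightarrow> nat pair_pre_digraph \<Rightarrow> mem" where
  "graph_input n G = (\<lambda>a i.
     if a = 0 \<and> i = 0 then n
     else if a = 1 \<and> i < n * n \<and> (i div n, i mod n) \<in> parcs G then 1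
     else 0)"

definition time :: "(event \<times> mem) list \<Rightarrow> nat" where
  "time tr = length tr"

text \<open>
  The outputs are exactly the members of \<open>F\<close>, without repetition, each given by its values at
  \<open>0, \<dots>, n - 1\<close>.
\<close>

definition enumerates :: "nat \<Rightarrow> (event \<times> mem) list \<Rightarrow> (nat \<Rightarrow> nat) set \<Rightarrow> bool" where
  "enumerates n tr F \<longleftrightarrow>
     (\<exists>fs. distinct fs \<and> set fs = F \<and>
        filter (\<lambda>e. e \<noteq> Silent) (map fst tr) =
        concat (map (\<lambda>f. map (\<lambda>v. Symbol (f v)) [0..<n] @ [End]) fs))"

text \<open>
  Any stretch of consecutive steps in which no output is completed has length at most \<open>d\<close>; this
  covers the time before the first, between consecutive, and after the last output.
\<close>

definition delay_at_most :: "nat \<Rightarrow> (event \<times> mem) list \<Rightarrow> bool" where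
  "delay_at_most d tr \<longleftrightarrow>
     (\<forall>xs ys zs. tr = xs @ ys @ zs \<and> End \<notin> fst ` set ys \<longrightarrow> length ys \<le> d)"

text \<open>
  In the initial memory \<open>s\<close> and after each step, only the first \<open>m\<close> cells of each array are in
  use (the others are 0), and all cells contain numbers below \<open>w\<close>. For a program with \<open>k\<close> arrays
  this amounts to \<open>k * m\<close> cells of \<open>log 2 w\<close> bits (rounded up).
\<close>

definition space_at_most :: "nat \<Rightarrow> nat \<Rightarrow> mem \<Rightarrow> (event \<times> mem) list \<Rightarrow> bool" where
  "space_at_most m w s tr \<longleftrightarrow>
     (\<forall>t \<in> insert s (snd ` set tr). \<forall>a i. (m \<le> i \<longrightarrow> t a i = 0) \<and> t a i < w)"

end

theory Submission
  imports Defs "HOL-Real_Asymp.Real_Asymp"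
begin

text \<open>
  A minimal Roman dominating function is determined by the set \<open>D\<close> of vertices of value 2, and the sets
  that occur are those in which every vertex has a private neighbour, i.e. a neighbour outside of \<open>D\<close>
  that has no other neighbour in \<open>D\<close>. This family is closed under subsets. Hence counting in binary,
  while skipping all sets above one that is not in the family, never runs into a dead end and yields
  polynomial delay. The total time is then governed by the size of the family.

  The size is bounded by branching at a simplicial vertex \<open>v\<close>, which every induced subgraph of a chordal
  graph has. If \<open>v\<close> is chosen, none of its neighbours is, since it would be adjacent to the private
  neighbour of \<open>v\<close>. If \<open>v\<close> is not chosen, we branch on its first neighbour that is chosen: the
  neighbourhood is a clique, so all earlier ones cease to be useful as private neighbours.
\<close>

text \<open>A vertex does not count as its own private neighbour, unlike in ordinary irredundance:
  lowering it from 2 to 1 leaves it satisfied, so only another vertex of value 0 can forbid this.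
  The obstacle in the count is that a vertex that is not chosen cannot simply be deleted, since it
  may be the private neighbour of a later choice. So instances consist of undecided vertices
  \<open>U\<close> and rejected vertices \<open>B\<close>, weighted by 15/8 and 3/2. These weights
  make every branching contract: the tightest ratios are 224/225, for an undecided simplicial vertex
  with one undecided and no rejected neighbour, and 80/81, for a rejected one with three undecided
  neighbours. At the start everything is undecided, so the family has at most (15/8)^n members. As
  15/8 = 1.875 < 1.8940, the exponential gap absorbs the polynomial delay per output. Chordality
  enters through the count, where it supplies the simplicial vertices.\<close>

section \<open>Simplicial vertices of chordal graphs\<close>

text \<open>A relation and a vertex set stand for the induced subgraph, so that inductions can
  shrink \<open>W\<close> without forming new graphs.\<close>

definition simplicial :: "('a \<times> 'a) set \<Rightarrow> 'a set \<Rightarrow> 'a \<Rightarrow> bool" where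
  "simplicial R W v \<longleftrightarrow>
     v \<in> W \<and> (\<forall>x \<in> W. \<forall>y \<in> W. (v, x) \<in> R \<longrightarrow> (v, y) \<in> R \<longrightarrow> x \<noteq> y \<longrightarrow> (x, y) \<in> R)"

text \<open>Repeated vertices are allowed, and the ends may lie outside of \<open>H\<close>. That a
  shortest such walk is an induced path is derived from minimality.\<close>

definition walk_through :: "('a \<times> 'a) set \<Rightarrow> 'a set \<Rightarrow> 'a \<Rightarrow> 'a \<Rightarrow> 'a list \<Rightarrow> bool" where
  "walk_through R H s t p \<longleftrightarrow>
     p \<noteq> [] \<and> hd p = s \<and> last p = t \<and>
     (\<forall>i. Suc i < length p \<longrightarrow> (p ! i, p ! Suc i) \<in> R) \<and>
     (\<forall>i. 0 < i \<longrightarrow> Suc i < length p \<longrightarrow> p ! i \<in> H)"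

text \<open>A chord can replace the stretch between its ends, and the interior vertices that survive
  were interior before.\<close>

lemma walk_through_shortcut:
  assumes p: "walk_through R H s t p" and ij: "Suc i < j" "j < length p" and adj: "(p ! i, p ! j) \<in> R"
  shows "walk_through R H s t (take (Suc i) p @ drop j p)" (is "walk_through R H s t ?q")
proof -
  have len: "length ?q = Suc i + (length p - j)"
    using ij by simp
  have nth: "?q ! k = (if k \<le> i then p ! k else p ! (k - Suc i + j))" if "k < length ?q" for k
    using that ij by (auto simp: nth_append add.commute)
  have "hd ?q = s"
    using p by (cases p) (auto simp: walk_through_def)
  moreover have "last ?q = t"
    using p ij by (auto simp: walk_through_def)
  moreover have "(?q ! k, ?q ! Suc k) \<in> R" if k: "Suc k < length ?q" for k
  proof -
    consider "k < i" | "k = i" | "i < k" by linarith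
    then show ?thesis
    proof cases
      case 1
      then show ?thesis using p ij k nth[of k] nth[of "Suc k"] by (auto simp: walk_through_def)
    next
      case 2
      then show ?thesis using adj k nth[of k] nth[of "Suc k"] by auto
    next
      case 3
      then have eq: "Suc k - Suc i + j = Suc (k - Suc i + j)" by simp
      moreover have "Suc (k - Suc i + j) < length p"
        using 3 k ij len by linarith
      ultimately show ?thesis
        using p 3 k nth[of k] nth[of "Suc k"] unfolding walk_through_def by (metis Suc_lessD not_le less_SucI)
    qed
  qed
  moreover have "?q ! k \<in> H" if k: "0 < k" "Suc k < length ?q" for k
  proof (cases "k \<le> i")
    case True
    then show ?thesis using p ij k nth[of k] by (auto simp: walk_through_def)
  next
    case False
    then have "Suc (k - Suc i + j) < length p" "0 < k - Suc i + j"
      using k ij len by linarith+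
    then show ?thesis using p False k nth[of k] by (auto simp: walk_through_def)
  qed
  moreover have "?q \<noteq> []"
    using p by (auto simp: walk_through_def)
  ultimately show ?thesis
    unfolding walk_through_def by blast
qed

text \<open>A chord would yield a shorter walk. A repetition \<open>p ! i = p ! j\<close> yields the
  chord from \<open>i\<close> to \<open>Suc j\<close>, unless \<open>j\<close> is the last index;
  then the repeated vertex is \<open>t\<close>, which is neither \<open>s\<close> nor in
  \<open>H\<close>.\<close>

lemma shortest_walk_through:
  assumes p: "walk_through R H s t p"
    and min: "\<And>q. walk_through R H s t q \<Longrightarrow> length p \<le> length q"
    and st: "s \<noteq> t" "s \<notin> H" "t \<notin> H"
  shows shortest_no_chord: "Suc i < j \<Longrightarrow> j < length p \<Longrightarrow> (p ! i, p ! j) \<notin> R"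
    and shortest_distinct: "distinct p"
proof -
  have nochord: "(p ! i, p ! j) \<notin> R" if ij: "Suc i < j" "j < length p" for i j
  proof
    assume "(p ! i, p ! j) \<in> R"
    from min[OF walk_through_shortcut[OF p ij this]] ij show False by simp
  qed
  show "Suc i < j \<Longrightarrow> j < length p \<Longrightarrow> (p ! i, p ! j) \<notin> R" by (fact nochord)
  have "p ! i \<noteq> p ! j" if ij: "i < j" "j < length p" for i j
  proof
    assume eq: "p ! i = p ! j"
    show False
    proof (cases "Suc j < length p")
      case True
      then have "(p ! i, p ! Suc j) \<in> R"
        using p eq by (simp add: walk_through_def)
      with nochord[of i "Suc j"] ij True show False by simp
    next
      case False
      then have "p ! j = t"
        using p ij by (metis walk_through_def Suc_lessI diff_Suc_1 last_conv_nth)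
      moreover have "p ! i = s" if "i = 0"
        using p that by (auto simp: walk_through_def hd_conv_nth)
      moreover have "p ! i \<in> H" if "i \<noteq> 0"
        using p that ij by (simp add: walk_through_def)
      ultimately show False using st eq by metis
    qed
  qed
  then show "distinct p"
    unfolding distinct_conv_nth by (metis nat_neq_iff)
qed

text \<open>Removes the modulus from \<open>induced_cycle\<close>: for ordered indices the only
  wrap-around is from the last to the first.\<close>

lemma mod_Suc_cases:
  fixes i j L :: nat
  assumes "i < j" "j < L"
  shows "j = Suc i mod L \<or> i = Suc j mod L \<longleftrightarrow> j = Suc i \<or> (i = 0 \<and> Suc j = L)"
  using assms by (cases "Suc j = L") auto

lemma walk_through_of_rtrancl:
  assumes "(c, d) \<in> (R \<inter> H \<times> H)\<^sup>*" "c \<in> H"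
  shows "\<exists>p. p \<noteq> [] \<and> hd p = c \<and> last p = d \<and> set p \<subseteq> H \<and>
    (\<forall>i. Suc i < length p \<longrightarrow> (p ! i, p ! Suc i) \<in> R)"
  using assms(1)
proof (induction rule: rtrancl_induct)
  case base
  show ?case using assms(2) by (intro exI[of _ "[c]"]) auto
next
  case (step y z)
  then obtain p where p: "p \<noteq> []" "hd p = c" "last p = y" "set p \<subseteq> H"
      "\<forall>i. Suc i < length p \<longrightarrow> (p ! i, p ! Suc i) \<in> R"
    by blast
  have "((p @ [z]) ! i, (p @ [z]) ! Suc i) \<in> R" if "Suc i < length (p @ [z])" for i
  proof (cases "Suc i < length p")
    case True
    then show ?thesis using p by (simp add: nth_append)
  next
    case False
    then have "i = length p - 1" "i < length p" using that by auto
    then show ?thesis using p step by (auto simp: nth_append last_conv_nth)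
  qed
  then show ?case using p step by (intro exI[of _ "p @ [z]"]) auto
qed

text \<open>Otherwise a shortest walk from \<open>s\<close> to \<open>t\<close> through
  \<open>H\<close> is an induced path with at least three vertices. Its interior avoids
  \<open>a\<close> and the neighbours of \<open>a\<close>, so \<open>a\<close> closes it to an
  induced cycle of length at least four.\<close>

lemma chordal_separator_clique:
  assumes chordal: "chordal G" and sym: "sym (parcs G)" and irrefl: "irrefl (parcs G)"
    and a: "a \<in> pverts G" and H: "H \<subseteq> pverts G" "\<And>x. x \<in> H \<Longrightarrow> x \<noteq> a \<and> (a, x) \<notin> parcs G"
    and st: "s \<in> pverts G" "t \<in> pverts G" "(a, s) \<in> parcs G" "(a, t) \<in> parcs G" "s \<noteq> t"
    and cd: "(s, c) \<in> parcs G" "(d, t) \<in> parcs G" "c \<in> H" "(c, d) \<in> (parcs G \<inter> H \<times> H)\<^sup>*"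
  shows "(s, t) \<in> parcs G"
proof (rule ccontr)
  let ?R = "parcs G"
  assume nst: "(s, t) \<notin> ?R"
  have symD: "(y, x) \<in> ?R" if "(x, y) \<in> ?R" for x y
    using sym that by (auto dest: symD)
  have nrefl: "(x, x) \<notin> ?R" for x
    using irrefl by (auto simp: irrefl_def)
  have sH: "s \<notin> H" and tH: "t \<notin> H"
    using H(2) st by blast+
  have "\<exists>p. walk_through ?R H s t p"
  proof -
    obtain q where q: "q \<noteq> []" "hd q = c" "last q = d" "set q \<subseteq> H"
        "\<forall>i. Suc i < length q \<longrightarrow> (q ! i, q ! Suc i) \<in> ?R"
      using walk_through_of_rtrancl[OF cd(4) cd(3)] by blast
    let ?p = "s # q @ [t]"
    have "(?p ! i, ?p ! Suc i) \<in> ?R" if "Suc i < length ?p" for i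
    proof -
      consider "i = 0" | "i = length q" "i \<noteq> 0" | "0 < i" "i < length q"
        using \<open>Suc i < length ?p\<close> by fastforce
      then show ?thesis
      proof cases
        case 1
        then show ?thesis using cd q by (simp add: nth_append hd_conv_nth)
      next
        case 2
        then show ?thesis using cd q by (auto simp: nth_append last_conv_nth nth_Cons')
      next
        case 3
        then show ?thesis using q(5) by (cases i) (auto simp: nth_append)
      qed
    qed
    moreover have "?p ! i \<in> H" if "0 < i" "Suc i < length ?p" for i
      using that q by (cases i) (auto simp: nth_append)
    ultimately have "walk_through ?R H s t ?p"
      by (auto simp: walk_through_def)
    then show ?thesis by blast
  qed
  then obtain p where p: "walk_through ?R H s t p"
    and min: "\<And>q. walk_through ?R H s t q \<Longrightarrow> length p \<le> length q"
    using ex_has_least_nat[of "walk_through ?R H s t" _ length] by blast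
  note nochord = shortest_no_chord[OF p min st(5) sH tH]
    and dist = shortest_distinct[OF p min st(5) sH tH]
  have p0: "p ! 0 = s" "p \<noteq> []"
    using p by (auto simp: walk_through_def hd_conv_nth)
  have pl: "p ! (length p - 1) = t"
    using p by (auto simp: walk_through_def last_conv_nth)
  have step: "(p ! i, p ! Suc i) \<in> ?R" if "Suc i < length p" for i
    using p that by (simp add: walk_through_def)
  have inner: "p ! i \<in> H" if "0 < i" "Suc i < length p" for i
    using p that by (simp add: walk_through_def)
  have len: "3 \<le> length p"
  proof (rule ccontr)
    assume "\<not> 3 \<le> length p"
    then have "length p = 1 \<or> length p = 2"
      using p0 length_greater_0_conv[of p] by linarith
    then show False
      using p0 pl st(5) nst step[of 0] by auto
  qed
  have adj_a: "(a, p ! k) \<in> ?R \<longleftrightarrow> k = 0 \<or> Suc k = length p" if k: "k < length p" for k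
  proof -
    consider "k = 0" | "Suc k = length p" | "0 < k" "Suc k < length p"
      using k by linarith
    then show ?thesis
    proof cases
      case 1
      then show ?thesis using p0 st by simp
    next
      case 2
      then have "k = length p - 1" by simp
      then show ?thesis using pl st 2 by simp
    next
      case 3
      then show ?thesis using inner[of k] H(2) by auto
    qed
  qed
  have p_verts: "p ! k \<in> pverts G \<and> p ! k \<noteq> a" if k: "k < length p" for k
  proof -
    consider "k = 0" | "k = length p - 1" | "0 < k" "Suc k < length p"
      using k by linarith
    then show ?thesis
    proof cases
      case 1
      then show ?thesis using p0 st nrefl by metis
    next
      case 2
      then show ?thesis using pl st nrefl by metis
    next
      case 3
      then show ?thesis using inner[of k] H by auto
    qed
  qed
  let ?c = "a # p"
  let ?L = "length ?c"
  have less: "(?c ! i, ?c ! j) \<in> ?R \<longleftrightarrow> j = Suc i \<or> (i = 0 \<and> Suc j = ?L)" if ij: "i < j" "j < ?L" for i j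
  proof (cases i)
    case 0
    then show ?thesis using adj_a[of "j - 1"] ij by (cases j) auto
  next
    case (Suc i')
    then obtain j' where j': "j = Suc j'" "i' < j'" using ij by (cases j) auto
    then show ?thesis
      using Suc ij step[of i'] nochord[of i' j'] by (cases "j' = Suc i'") auto
  qed
  have "(?c ! i, ?c ! j) \<in> ?R \<longleftrightarrow> j = Suc i mod ?L \<or> i = Suc j mod ?L" if "i < ?L" "j < ?L" for i j
  proof -
    consider "i < j" | "j < i" | "i = j" by linarith
    then show ?thesis
    proof cases
      case 1
      then show ?thesis using less[of i j] mod_Suc_cases[of i j ?L] that by blast
    next
      case 2
      then show ?thesis using less[of j i] mod_Suc_cases[of j i ?L] that symD by blast
    next
      case 3
      have "i \<noteq> Suc i mod ?L"
        using that len by (cases "Suc i = ?L") auto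
      then show ?thesis using 3 nrefl by simp
    qed
  qed
  moreover have "distinct ?c"
    using dist p_verts by (auto simp: in_set_conv_nth)
  moreover have "set ?c \<subseteq> pverts G"
    using a p_verts by (auto simp: in_set_conv_nth)
  ultimately have "induced_cycle G ?c \<and> 4 \<le> length ?c"
    unfolding induced_cycle_def using len by auto
  with chordal show False unfolding chordal_def by blast
qed

text \<open>
  Dirac's argument: the neighbourhood of a component of the non-neighbours of \<open>a\<close> is a clique, so
  one of two non-adjacent simplicial vertices of the component and its neighbourhood lies in the
  component.
\<close>
lemma simplicial_non_neighbour:
  assumes chordal: "chordal G" and sym: "sym (parcs G)" and irrefl: "irrefl (parcs G)"
    and W: "finite W" "W \<subseteq> pverts G"
    and ab: "a \<in> W" "b \<in> W" "b \<noteq> a" "(a, b) \<notin> parcs G"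
  shows "\<exists>v. simplicial (parcs G) W v \<and> v \<noteq> a \<and> (a, v) \<notin> parcs G"
  using W ab
proof (induction "card W" arbitrary: W a b rule: less_induct)
  case less
  let ?R = "parcs G"
  have symD: "(y, x) \<in> ?R" if "(x, y) \<in> ?R" for x y
    using sym that by (auto dest: symD)
  define H where "H = {x \<in> W. x \<noteq> a \<and> (a, x) \<notin> ?R}"
  define C where "C = {x. (b, x) \<in> (?R \<inter> H \<times> H)\<^sup>*}"
  define S where "S = {s \<in> W. s \<notin> C \<and> (\<exists>c \<in> C. (s, c) \<in> ?R)}"
  have bH: "b \<in> H" using less.prems by (simp add: H_def)
  have CH: "C \<subseteq> H"
  proof
    fix x assume "x \<in> C"
    then have "(b, x) \<in> (?R \<inter> H \<times> H)\<^sup>*" by (simp add: C_def)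
    then show "x \<in> H" using bH by (cases rule: rtranclE) auto
  qed
  have bC: "b \<in> C" by (simp add: C_def)
  have nbr_C: "x \<in> C \<union> S" if "c \<in> C" "x \<in> W" "(c, x) \<in> ?R" for c x
    using that(1,2) symD[OF that(3)] by (auto simp: S_def)
  have S_adj: "(a, s) \<in> ?R" if s: "s \<in> S" for s
  \<comment> \<open>A non-neighbour of \<open>a\<close> that touches the component \<open>C\<close>
    would belong to \<open>C\<close> itself.\<close>
  proof (rule ccontr)
    assume n: "(a, s) \<notin> ?R"
    obtain c where c: "c \<in> C" "(s, c) \<in> ?R" using s by (auto simp: S_def)
    then have "s \<noteq> a" using CH by (auto simp: H_def)
    then have "s \<in> H" using n s by (auto simp: H_def S_def)
    then have "(c, s) \<in> ?R \<inter> H \<times> H" using c CH symD[OF c(2)] by auto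
    then have "s \<in> C" using c(1) unfolding C_def by (auto intro: rtrancl_into_rtrancl)
    then show False using s by (simp add: S_def)
  qed
  have symRH: "sym ((?R \<inter> H \<times> H)\<^sup>*)"
    by (rule sym_rtrancl) (auto simp: sym_def symD)
  have S_clique: "(s, t) \<in> ?R" if st: "s \<in> S" "t \<in> S" "s \<noteq> t" for s t
  proof -
    obtain c d where cd: "c \<in> C" "(s, c) \<in> ?R" "d \<in> C" "(t, d) \<in> ?R"
      using st unfolding S_def by blast
    have "(b, c) \<in> (?R \<inter> H \<times> H)\<^sup>*" "(b, d) \<in> (?R \<inter> H \<times> H)\<^sup>*"
      using cd by (simp_all add: C_def)
    then have "(c, d) \<in> (?R \<inter> H \<times> H)\<^sup>*"
      by (metis symE symRH rtrancl_trans)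
    moreover have "c \<in> H" "(d, t) \<in> ?R" "(a, s) \<in> ?R" "(a, t) \<in> ?R" "s \<in> pverts G" "t \<in> pverts G"
      using cd st CH S_adj symD[OF cd(4)] less.prems(2) by (auto simp: S_def)
    moreover have "a \<in> pverts G" "H \<subseteq> pverts G" "\<And>x. x \<in> H \<Longrightarrow> x \<noteq> a \<and> (a, x) \<notin> ?R"
      using less.prems by (auto simp: H_def)
    ultimately show ?thesis
      using chordal_separator_clique[OF chordal sym irrefl, of a H s t c d] cd(2) st(3) by blast
  qed
  let ?W = "C \<union> S"
  have aW: "a \<notin> ?W" using CH S_adj irrefl by (auto simp: H_def irrefl_def)
  have WW: "?W \<subseteq> W" using CH by (auto simp: H_def S_def)
  have card: "card ?W < card W"
    using aW WW less.prems by (intro psubset_card_mono) auto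
  have "\<exists>v \<in> C. simplicial ?R ?W v"
  proof (cases "\<exists>x \<in> ?W. \<exists>y \<in> ?W. y \<noteq> x \<and> (x, y) \<notin> ?R")
    case True
    then obtain x y where xy: "x \<in> ?W" "y \<in> ?W" "y \<noteq> x" "(x, y) \<notin> ?R" by blast
    have fin: "finite ?W" "?W \<subseteq> pverts G"
      using WW less.prems finite_subset by auto
    obtain v where v: "simplicial ?R ?W v" "v \<noteq> x" "(x, v) \<notin> ?R"
      using less.hyps[OF card fin xy] by blast
    have vW: "v \<in> ?W" using v by (simp add: simplicial_def)
    \<comment> \<open>The hypothesis is applied again, now with \<open>v\<close> in the role of
      \<open>a\<close> and \<open>x\<close> as its non-neighbour. The resulting \<open>w\<close> is
      not adjacent to \<open>v\<close>, so the clique \<open>S\<close> cannot contain both.\<close>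
    obtain w where w: "simplicial ?R ?W w" "w \<noteq> v" "(v, w) \<notin> ?R"
      using less.hyps[OF card fin vW xy(1)] v symD[of v x] by blast
    have "w \<in> ?W" using w by (simp add: simplicial_def)
    then have "v \<in> C \<or> w \<in> C"
      using vW w S_clique by blast
    then show ?thesis using v w by blast
  next
    case False
    then have "\<forall>x \<in> ?W. \<forall>y \<in> ?W. x \<noteq> y \<longrightarrow> (x, y) \<in> ?R" by metis
    then have "simplicial ?R ?W b" using bC unfolding simplicial_def by blast
    then show ?thesis using bC by blast
  qed
  then obtain v where v: "v \<in> C" "simplicial ?R ?W v" by blast
  \<comment> \<open>Being simplicial in \<open>C\<close> with \<open>S\<close> lifts to
    \<open>W\<close>, because a vertex of \<open>C\<close> has no further neighbours in
    \<open>W\<close>.\<close>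
  have "simplicial ?R W v"
    unfolding simplicial_def
  proof (intro conjI ballI impI)
    show "v \<in> W" using v WW by blast
    fix x y assume xy: "x \<in> W" "y \<in> W" "(v, x) \<in> ?R" "(v, y) \<in> ?R" "x \<noteq> y"
    then have "x \<in> ?W" "y \<in> ?W" using nbr_C[OF v(1)] by blast+
    with v(2) xy show "(x, y) \<in> ?R" unfolding simplicial_def by blast
  qed
  then show ?case using v CH by (auto simp: H_def)
qed

theorem chordal_simplicial:
  assumes "chordal G" "sym (parcs G)" "irrefl (parcs G)" "finite W" "W \<subseteq> pverts G" "W \<noteq> {}"
  obtains v where "simplicial (parcs G) W v"
proof (cases "\<exists>a \<in> W. \<exists>b \<in> W. b \<noteq> a \<and> (a, b) \<notin> parcs G")
  case True
  then show thesis using simplicial_non_neighbour[OF assms(1-5)] that by blast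
next
  case False
  moreover obtain v where "v \<in> W" using assms(6) by blast
  ultimately have "simplicial (parcs G) W v" unfolding simplicial_def by metis
  then show thesis by (rule that)
qed

section \<open>Sets with private neighbours\<close>

text \<open>An instance of the branching: \<open>U\<close> is undecided, and \<open>B\<close> is
  rejected but still available as private neighbours. Vertices in neither have been deleted.\<close>

definition private_sets :: "('a \<times> 'a) set \<Rightarrow> 'a set \<Rightarrow> 'a set \<Rightarrow> 'a set set" where
  "private_sets R U B = {D. D \<subseteq> U \<and>
     (\<forall>v \<in> D. \<exists>w \<in> U \<union> B. w \<notin> D \<and> (w, v) \<in> R \<and> (\<forall>u \<in> D. (w, u) \<in> R \<longrightarrow> u = v))}"

lemma finite_private_sets: "finite U \<Longrightarrow> finite (private_sets R U B)"
  by (rule finite_subset[of _ "Pow U"]) (auto simp: private_sets_def)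

text \<open>A private neighbour stays private when other chosen vertices are dropped.\<close>

lemma private_sets_hereditary:
  assumes "D \<in> private_sets R U B" "D' \<subseteq> D"
  shows "D' \<in> private_sets R U B"
  unfolding private_sets_def
proof (intro CollectI conjI ballI)
  show "D' \<subseteq> U" using assms by (auto simp: private_sets_def)
  fix v assume v: "v \<in> D'"
  then obtain w where "w \<in> U \<union> B" "w \<notin> D" "(w, v) \<in> R" "\<forall>u \<in> D. (w, u) \<in> R \<longrightarrow> u = v"
    using assms unfolding private_sets_def by blast
  then show "\<exists>w \<in> U \<union> B. w \<notin> D' \<and> (w, v) \<in> R \<and> (\<forall>u \<in> D'. (w, u) \<in> R \<longrightarrow> u = v)"
    using assms(2) by blast
qed

text \<open>
  A neighbour of a chosen vertex \<open>x\<close> that is not chosen itself can only be private for \<open>x\<close>. We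
  also give up the requirement that \<open>x\<close> has a private neighbour.
\<close>
lemma private_sets_delete_chosen:
  assumes "D \<in> private_sets R U B" "x \<in> D" "D \<inter> Q = {}" "\<And>q. q \<in> Q \<Longrightarrow> (q, x) \<in> R"
  shows "D - {x} \<in> private_sets R (U - insert x Q) (B - Q)"
  unfolding private_sets_def
proof (intro CollectI conjI ballI)
  show "D - {x} \<subseteq> U - insert x Q" using assms by (auto simp: private_sets_def)
  fix v assume v: "v \<in> D - {x}"
  then obtain w where w: "w \<in> U \<union> B" "w \<notin> D" "(w, v) \<in> R" "\<forall>u \<in> D. (w, u) \<in> R \<longrightarrow> u = v"
    using assms unfolding private_sets_def by blast
  then have "(w, x) \<notin> R" using assms v by blast
  then have "w \<notin> Q" using assms by blast
  then have "w \<in> (U - insert x Q) \<union> (B - Q)" using w assms by blast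
  with w show "\<exists>w \<in> (U - insert x Q) \<union> (B - Q).
      w \<notin> D - {x} \<and> (w, v) \<in> R \<and> (\<forall>u \<in> D - {x}. (w, u) \<in> R \<longrightarrow> u = v)"
    by blast
qed

text \<open>Deleting \<open>x\<close> is injective on the sets that contain it. \<open>Q\<close> is
  meant for the neighbours of \<open>x\<close> that are known not to be chosen.\<close>

lemma card_private_sets_chosen:
  assumes "finite U" "\<And>q. q \<in> Q \<Longrightarrow> (q, x) \<in> R"
  shows "card {D \<in> private_sets R U B. x \<in> D \<and> D \<inter> Q = {}}
    \<le> card (private_sets R (U - insert x Q) (B - Q))"
proof (rule card_inj_on_le)
  show "inj_on (\<lambda>D. D - {x}) {D \<in> private_sets R U B. x \<in> D \<and> D \<inter> Q = {}}"
    by (rule inj_onI) blast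
  show "(\<lambda>D. D - {x}) ` {D \<in> private_sets R U B. x \<in> D \<and> D \<inter> Q = {}}
      \<subseteq> private_sets R (U - insert x Q) (B - Q)"
    using private_sets_delete_chosen[of _ R U B x Q] assms(2) by blast
  show "finite (private_sets R (U - insert x Q) (B - Q))"
    using assms(1) by (intro finite_private_sets) auto
qed

lemma private_sets_reject:
  assumes "D \<in> private_sets R U B" "D \<inter> Q = {}" "Q \<subseteq> U"
  shows "D \<in> private_sets R (U - Q) (B \<union> Q)"
proof -
  have "(U - Q) \<union> (B \<union> Q) = U \<union> B" using assms(3) by blast
  then show ?thesis using assms by (auto simp: private_sets_def)
qed

text \<open>A vertex that sees no undecided vertex can be private for nobody.\<close>

lemma private_sets_delete_rejected:
  assumes "D \<in> private_sets R U B" "\<And>u. u \<in> U \<Longrightarrow> (b, u) \<notin> R"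
  shows "D \<in> private_sets R U (B - {b})"
  unfolding private_sets_def
proof (intro CollectI conjI ballI)
  show D: "D \<subseteq> U" using assms by (auto simp: private_sets_def)
  fix v assume v: "v \<in> D"
  then obtain w where w: "w \<in> U \<union> B" "w \<notin> D" "(w, v) \<in> R" "\<forall>u \<in> D. (w, u) \<in> R \<longrightarrow> u = v"
    using assms unfolding private_sets_def by blast
  then have "w \<noteq> b" using assms(2) D v by blast
  with w show "\<exists>w \<in> U \<union> (B - {b}). w \<notin> D \<and> (w, v) \<in> R \<and> (\<forall>u \<in> D. (w, u) \<in> R \<longrightarrow> u = v)"
    by blast
qed

section \<open>Weights and branching ratios\<close>

text \<open>
  A rejected vertex may still serve as a private neighbour, so it keeps part of its weight.
\<close>
definition weight :: "'a set \<Rightarrow> 'a set \<Rightarrow> real" where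
  "weight U B = (15/8) ^ card U * (3/2) ^ card B"

text \<open>
  The ratio of the bounds after and before branching on the \<open>u\<close> undecided neighbours of a
  rejected simplicial vertex \<open>v\<close>. If none is chosen, they become rejected and \<open>v\<close> becomes useless:
  \<open>(2/3) * ((3/2) * (8/15)) ^ u\<close>. If the \<open>i\<close>-th one is the first that is chosen, its neighbours \<open>v\<close> and
  the earlier ones are of no further use.
\<close>
definition rejected_factor :: "nat \<Rightarrow> real" where
  "rejected_factor u = 2/3 * ((4/5) ^ u + (\<Sum>i<u. (8/15) ^ Suc i))"

lemma rejected_factor_closed: "rejected_factor u = 2/3 * ((4/5) ^ u + 8/7 * (1 - (8/15) ^ u))"
proof -
  have "(\<Sum>i<u. (8/15 :: real) ^ Suc i) = 8/7 * (1 - (8/15) ^ u)"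
  proof (induction u)
    case (Suc u)
    then have "(\<Sum>i<Suc u. (8/15 :: real) ^ Suc i) = 8/7 * (1 - (8/15) ^ u) + (8/15) ^ Suc u"
      by simp
    also have "\<dots> = 8/7 * (1 - (8/15) ^ Suc u)" by (simp add: algebra_simps)
    finally show ?case .
  qed simp
  then show ?thesis by (simp add: rejected_factor_def)
qed

text \<open>The maximum is 80/81 at \<open>u = 3\<close>. From 5 on, the geometric sum can be
  replaced by its limit 8/7; for \<open>u = 4\<close> this would be too crude.\<close>

lemma rejected_factor_le: "rejected_factor u \<le> 1"
proof (cases "u < 5")
  case True
  then have "u \<in> {0, 1, 2, 3, 4}" by auto
  then show ?thesis by (auto simp: rejected_factor_closed power_numeral_reduce)
next
  case False
  then have "(4/5 :: real) ^ u \<le> (4/5) ^ 5" by (intro power_decreasing) auto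
  also have "\<dots> \<le> 3/2 - 8/7" by (simp add: power_numeral_reduce)
  finally have "(4/5 :: real) ^ u \<le> 3/2 - 8/7" .
  moreover have "(8/15 :: real) ^ u \<ge> 0" by simp
  ultimately show ?thesis unfolding rejected_factor_closed by argo
qed

text \<open>The ratio for an undecided simplicial vertex with \<open>u\<close> undecided and
  \<open>b\<close> rejected neighbours. Choosing it removes it together with all of them. Rejecting
  it turns 15/8 into 3/2, a factor 4/5, and the branching for rejected vertices follows. For
  \<open>u = b = 0\<close> the sum would be 16/15, so isolated vertices are handled
  separately.\<close>

lemma undecided_factor_le:
  assumes "0 < u + b"
  shows "(8/15) ^ Suc u * (2/3) ^ b + 4/5 * rejected_factor u \<le> (1::real)"
proof -
  have b: "(2/3 :: real) ^ b \<le> 1" by (rule power_le_one) auto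
  have "(8/15 :: real) ^ Suc u * (2/3) ^ b \<le> (8/15) ^ Suc u"
    using mult_left_mono[OF b, of "(8/15) ^ Suc u"] by simp
  moreover have "(8/15) ^ Suc u + 4/5 * rejected_factor u \<le> (1::real)" if "u \<ge> 1"
  proof (cases "u < 3")
    case True
    then have "u \<in> {1, 2}" using that by auto
    then show ?thesis by (auto simp: rejected_factor_closed power_numeral_reduce)
  next
    case False
    then have "(8/15 :: real) ^ Suc u \<le> (8/15) ^ 4" by (intro power_decreasing) auto
    also have "\<dots> \<le> 1/5" by (simp add: power_numeral_reduce)
    finally show ?thesis using rejected_factor_le[of u] by linarith
  qed
  moreover have ?thesis if "u = 0"
  proof -
    have "(2/3 :: real) ^ b \<le> (2/3) ^ 1" using that assms by (intro power_decreasing) auto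
    then show ?thesis using that by (simp add: rejected_factor_closed)
  qed
  ultimately show ?thesis by (cases "u = 0") linarith+
qed

lemma card_le_filter_add:
  assumes "finite F"
  shows "card F \<le> card {x \<in> F. P x} + card {x \<in> F. \<not> P x}"
proof -
  have "card F \<le> card ({x \<in> F. P x} \<union> {x \<in> F. \<not> P x})"
    using assms by (intro card_mono) auto
  then show ?thesis using card_Un_le le_trans by blast
qed

text \<open>A set that meets the list is counted at the first entry that it contains.\<close>

lemma card_hitting_le:
  assumes "finite F" "distinct xs"
    and "\<And>i. i < length xs \<Longrightarrow>
      real (card {D \<in> F. xs ! i \<in> D \<and> D \<inter> set (take i xs) = {}}) \<le> g i"
  shows "real (card {D \<in> F. D \<inter> set xs \<noteq> {}}) \<le> (\<Sum>i<length xs. g i)"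
  using assms(2,3)
proof (induction xs rule: rev_induct)
  case Nil
  then show ?case by simp
next
  case (snoc x xs)
  have IH: "real (card {D \<in> F. D \<inter> set xs \<noteq> {}}) \<le> (\<Sum>i<length xs. g i)"
  proof (rule snoc.IH)
    show "distinct xs" using snoc.prems by simp
    fix i assume "i < length xs"
    then show "real (card {D \<in> F. xs ! i \<in> D \<and> D \<inter> set (take i xs) = {}}) \<le> g i"
      using snoc.prems(2)[of i] by (simp add: nth_append)
  qed
  have last: "real (card {D \<in> F. x \<in> D \<and> D \<inter> set xs = {}}) \<le> g (length xs)"
    using snoc.prems(2)[of "length xs"] by simp
  have "{D \<in> F. D \<inter> set (xs @ [x]) \<noteq> {}}
      \<subseteq> {D \<in> F. D \<inter> set xs \<noteq> {}} \<union> {D \<in> F. x \<in> D \<and> D \<inter> set xs = {}}" (is "_ \<subseteq> ?A \<union> ?B")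
    by auto
  then have "card {D \<in> F. D \<inter> set (xs @ [x]) \<noteq> {}} \<le> card (?A \<union> ?B)"
    using assms(1) by (intro card_mono) auto
  also have "\<dots> \<le> card ?A + card ?B" by (rule card_Un_le)
  finally show ?case using IH last by simp
qed

section \<open>The branching at a simplicial vertex\<close>

locale chordal_graph =
  fixes G :: "'a pair_pre_digraph"
  assumes chordal: "chordal G" and sym: "sym (parcs G)" and irrefl: "irrefl (parcs G)"
begin

lemma arcs_swap: "(x, y) \<in> parcs G \<Longrightarrow> (y, x) \<in> parcs G"
  using sym by (rule symD)

text \<open>The induction hypothesis as a predicate, so that the branchings become separate lemmas.
  Undecided vertices count twice in the measure, hence moving one from \<open>U\<close> to
  \<open>B\<close> decreases it.\<close>

definition bounded_below :: "nat \<Rightarrow> bool" where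
  "bounded_below m \<longleftrightarrow> (\<forall>U B. finite U \<longrightarrow> finite B \<longrightarrow> U \<inter> B = {} \<longrightarrow> U \<union> B \<subseteq> pverts G \<longrightarrow>
     2 * card U + card B < m \<longrightarrow> real (card (private_sets (parcs G) U B)) \<le> weight U B)"

lemma bounded_belowD:
  assumes "bounded_below m" "finite U" "finite B" "U \<inter> B = {}" "U \<union> B \<subseteq> pverts G"
    "2 * card U + card B < m"
  shows "real (card (private_sets (parcs G) U B)) \<le> weight U B"
  using assms unfolding bounded_below_def by blast

lemma weight_diff:
  assumes "finite U" "finite B" "Q \<subseteq> U" "P \<subseteq> B"
  shows "weight (U - Q) (B - P) = weight U B * (8/15) ^ card Q * (2/3) ^ card P"
proof -
  have "card U = card (U - Q) + card Q" "card B = card (B - P) + card P"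
    using assms by (auto simp: card_Diff_subset card_mono finite_subset)
  then have "weight U B = (15/8) ^ card (U - Q) * (15/8) ^ card Q * ((3/2) ^ card (B - P) * (3/2) ^ card P)"
    by (simp add: weight_def power_add)
  moreover have "(15/8 :: real) ^ card Q * (8/15) ^ card Q = 1" "(3/2 :: real) ^ card P * (2/3) ^ card P = 1"
    by (simp_all flip: power_mult_distrib)
  ultimately show ?thesis
    by (simp add: weight_def algebra_simps)
qed

text \<open>The undecided neighbours form a clique together with \<open>v\<close>. So in any
  listing, each entry is adjacent to \<open>v\<close> and to all earlier entries, and choosing it
  makes these useless.\<close>

lemma card_private_sets_rejected_simplicial:
  assumes IH: "bounded_below m" and fin: "finite U" "finite B" and disj: "U \<inter> B = {}"
    and sub: "U \<union> B \<subseteq> pverts G" and m: "2 * card U + card B \<le> m"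
    and v: "v \<in> B" "simplicial (parcs G) (U \<union> B) v"
  shows "real (card (private_sets (parcs G) U B))
    \<le> weight U B * rejected_factor (card {x \<in> U. (v, x) \<in> parcs G})"
proof -
  let ?R = "parcs G" and ?F = "private_sets (parcs G) U B"
  define S where "S = {x \<in> U. (v, x) \<in> ?R}"
  have S: "finite S" "S \<subseteq> U" using fin by (auto simp: S_def)
  have adj: "(x, y) \<in> ?R" if "x \<in> S" "y \<in> S" "x \<noteq> y" for x y
    using v(2) that by (auto simp: simplicial_def S_def)
  have vS: "(v, x) \<in> ?R" if "x \<in> S" for x using that by (simp add: S_def)
  have finF: "finite ?F" using fin(1) by (rule finite_private_sets)
  have cardB: "0 < card B" using v fin card_gt_0_iff by blast
  obtain xs where xs: "set xs = S" "distinct xs" using S(1) finite_distinct_list by blast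
  have len: "length xs = card S" using xs distinct_card by metis

  have "{D \<in> ?F. D \<inter> S = {}} \<subseteq> private_sets ?R (U - S) ((B - {v}) \<union> S)"
  proof
    fix D assume "D \<in> {D \<in> ?F. D \<inter> S = {}}"
    then have "D \<in> private_sets ?R (U - S) (B \<union> S)"
      using private_sets_reject[of D ?R U B S] S by blast
    \<comment> \<open>With \<open>S\<close> rejected, \<open>v\<close> has no undecided neighbour
      left.\<close>
    then have "D \<in> private_sets ?R (U - S) ((B \<union> S) - {v})"
      by (rule private_sets_delete_rejected) (auto simp: S_def)
    moreover have "(B \<union> S) - {v} = (B - {v}) \<union> S" using S disj v by blast
    ultimately show "D \<in> private_sets ?R (U - S) ((B - {v}) \<union> S)" by simp
  qed
  then have "real (card {D \<in> ?F. D \<inter> S = {}}) \<le> real (card (private_sets ?R (U - S) ((B - {v}) \<union> S)))"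
    using fin by (simp add: card_mono finite_private_sets)
  also have "\<dots> \<le> weight (U - S) ((B - {v}) \<union> S)"
  proof (rule bounded_belowD[OF IH])
    \<comment> \<open>\<open>S\<close> may be empty; the strict decrease comes from deleting
      \<open>v\<close>.\<close>
    have "card (U - S) + card S = card U"
      using S fin by (simp add: card_Diff_subset card_mono)
    moreover have "card ((B - {v}) \<union> S) \<le> card (B - {v}) + card S" by (rule card_Un_le)
    moreover have "card (B - {v}) < card B" using card_Diff1_less[OF fin(2) v(1)] .
    ultimately show "2 * card (U - S) + card ((B - {v}) \<union> S) < m" using m by linarith
  qed (use fin S disj sub in auto)
  also have "\<dots> = weight (U - S) (B - {v}) * (3/2) ^ card S"
  proof -
    have "card ((B - {v}) \<union> S) = card (B - {v}) + card S"
      using S fin disj by (intro card_Un_disjoint) auto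
    then show ?thesis by (simp add: weight_def power_add)
  qed
  also have "\<dots> = weight U B * (2/3 * (4/5) ^ card S)"
  proof -
    have *: "(8/15 :: real) ^ card S * (3/2) ^ card S = (4/5) ^ card S"
      by (simp flip: power_mult_distrib)
    have "weight (U - S) (B - {v}) = weight U B * (8/15) ^ card S * (2/3)"
      using weight_diff[of U B S "{v}"] fin S v by simp
    then have "weight (U - S) (B - {v}) * (3/2) ^ card S
        = weight U B * (2/3 * ((8/15) ^ card S * (3/2) ^ card S))" by simp
    then show ?thesis by (simp only: *)
  qed
  finally have none: "real (card {D \<in> ?F. D \<inter> S = {}}) \<le> weight U B * (2/3 * (4/5) ^ card S)" .

  have "real (card {D \<in> ?F. D \<inter> set xs \<noteq> {}})
      \<le> (\<Sum>i<length xs. weight U B * (2/3) * (8/15) ^ Suc i)"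
  proof (rule card_hitting_le[OF finF xs(2)])
    fix i assume i: "i < length xs"
    let ?T = "set (take i xs)" and ?x = "xs ! i"
    have x: "?x \<in> S" using i xs by auto
    have xT: "?x \<notin> ?T" using i xs(2)
      by (metis distinct_append distinct_take not_distinct_conv_prefix take_Suc_conv_app_nth)
    have T: "?T \<subseteq> S" using xs(1) set_take_subset[of i xs] by simp
    have cT: "card (insert ?x ?T) = Suc i"
      using xT i xs(2) by (simp add: distinct_card)
    \<comment> \<open>As \<open>v\<close> is already rejected, it may be added to the vertices that
      \<open>D\<close> avoids, and is then deleted along with the earlier entries.\<close>
    have "{D \<in> ?F. ?x \<in> D \<and> D \<inter> ?T = {}} = {D \<in> ?F. ?x \<in> D \<and> D \<inter> insert v ?T = {}}"
      using v disj by (auto simp: private_sets_def)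
    also have "card \<dots> \<le> card (private_sets ?R (U - insert ?x (insert v ?T)) (B - insert v ?T))"
      using x xT T adj vS by (intro card_private_sets_chosen[OF fin(1)]) blast
    also have "U - insert ?x (insert v ?T) = U - insert ?x ?T"
      using v disj by blast
    also have "B - insert v ?T = B - {v}"
      using T S disj by blast
    finally have "real (card {D \<in> ?F. ?x \<in> D \<and> D \<inter> ?T = {}})
        \<le> real (card (private_sets ?R (U - insert ?x ?T) (B - {v})))" by simp
    also have "\<dots> \<le> weight (U - insert ?x ?T) (B - {v})"
    proof (rule bounded_belowD[OF IH])
      have "card (B - {v}) < card B" using card_Diff1_less[OF fin(2) v(1)] .
      moreover have "card (U - insert ?x ?T) \<le> card U" using fin by (simp add: card_mono)
      ultimately show "2 * card (U - insert ?x ?T) + card (B - {v}) < m" using m by linarith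
    qed (use fin disj sub in auto)
    also have "\<dots> = weight U B * (2/3) * (8/15) ^ Suc i"
    proof -
      have "insert ?x ?T \<subseteq> U" "{v} \<subseteq> B" using S v x T by blast+
      from weight_diff[OF fin this] show ?thesis by (simp only: cT) simp
    qed
    finally show "real (card {D \<in> ?F. ?x \<in> D \<and> D \<inter> ?T = {}}) \<le> weight U B * (2/3) * (8/15) ^ Suc i" .
  qed
  then have some: "real (card {D \<in> ?F. D \<inter> S \<noteq> {}})
      \<le> weight U B * (2/3 * (\<Sum>i<card S. (8/15) ^ Suc i))"
    using xs len by (simp add: sum_distrib_left mult.assoc)
  have "card ?F \<le> card {D \<in> ?F. D \<inter> S = {}} + card {D \<in> ?F. D \<inter> S \<noteq> {}}"
    by (rule card_le_filter_add[OF finF])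
  then have "real (card ?F) \<le> weight U B * (2/3 * (4/5) ^ card S)
      + weight U B * (2/3 * (\<Sum>i<card S. (8/15) ^ Suc i))"
    using none some by linarith
  then show ?thesis
    by (simp add: rejected_factor_def S_def distrib_left)
qed

lemma simplicial_chosen_excludes_neighbours:
  assumes D: "D \<in> private_sets (parcs G) U B" and v: "v \<in> D" "simplicial (parcs G) (U \<union> B) v"
    and x: "x \<in> D" "(v, x) \<in> parcs G"
  shows False
proof -
  obtain w where w: "w \<in> U \<union> B" "w \<notin> D" "(w, v) \<in> parcs G" "\<forall>u \<in> D. (w, u) \<in> parcs G \<longrightarrow> u = v"
    using D v unfolding private_sets_def by blast
  have "x \<in> U \<union> B" "w \<noteq> x" using D x w by (auto simp: private_sets_def)
  then have "(w, x) \<in> parcs G"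
    using v(2) w x arcs_swap[of w v] unfolding simplicial_def by blast
  then have "x = v" using w x by blast
  then show False using x irrefl by (auto simp: irrefl_def)
qed

lemma card_private_sets_undecided_simplicial:
  assumes IH: "bounded_below m" and fin: "finite U" "finite B" and disj: "U \<inter> B = {}"
    and sub: "U \<union> B \<subseteq> pverts G" and m: "2 * card U + card B \<le> m"
    and v: "v \<in> U" "simplicial (parcs G) (U \<union> B) v"
  shows "real (card (private_sets (parcs G) U B)) \<le> weight U B"
proof -
  let ?R = "parcs G" and ?F = "private_sets (parcs G) U B"
  define S where "S = {x \<in> U. (v, x) \<in> ?R}"
  define P where "P = {x \<in> B. (v, x) \<in> ?R}"
  have SP: "finite S" "S \<subseteq> U" "finite P" "P \<subseteq> B" using fin by (auto simp: S_def P_def)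
  have vB: "v \<notin> B" using v(1) disj by blast
  have vS: "v \<notin> S" using irrefl by (auto simp: S_def irrefl_def)
  have cU: "card (U - {v}) < card U" using card_Diff1_less[OF fin(1) v(1)] .
  have split: "card ?F \<le> card {D \<in> ?F. v \<in> D} + card {D \<in> ?F. v \<notin> D}"
    by (rule card_le_filter_add[OF finite_private_sets[OF fin(1)]])
  have notin: "{D \<in> ?F. v \<notin> D} \<subseteq> private_sets ?R (U - {v}) (insert v B)"
    using private_sets_reject[of _ ?R U B "{v}"] v by auto
  have w_moved: "weight (U - {v}) (insert v B) = weight U B * (4/5)"
  proof -
    have "card (insert v B) = Suc (card B)" using vB fin by simp
    then have "weight (U - {v}) (insert v B) = weight (U - {v}) (B - {}) * (3/2)"
      by (simp add: weight_def)
    then show ?thesis using weight_diff[of U B "{v}" "{}"] fin v by simp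
  qed
  have pos: "0 \<le> weight U B" by (simp add: weight_def)
  show ?thesis
  proof (cases "S \<union> P = {}")
    case True
    \<comment> \<open>An isolated \<open>v\<close> has no candidate for a private neighbour, so it
      is never chosen; nor can it be private for others. It is deleted at once.\<close>
    have "?F \<subseteq> private_sets ?R (U - {v}) B"
    proof
      fix D assume D: "D \<in> ?F"
      have "v \<notin> D"
      proof
        assume "v \<in> D"
        then obtain w where "w \<in> U \<union> B" "(w, v) \<in> ?R"
          using D unfolding private_sets_def by blast
        then show False using True arcs_swap[of w v] unfolding S_def P_def by blast
      qed
      then have "D \<in> private_sets ?R (U - {v}) (insert v B)" using notin D by blast
      then have "D \<in> private_sets ?R (U - {v}) (insert v B - {v})"
        by (rule private_sets_delete_rejected) (use True in \<open>auto simp: S_def\<close>)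
      moreover have "insert v B - {v} = B" using v disj by blast
      ultimately show "D \<in> private_sets ?R (U - {v}) B" by simp
    qed
    then have "real (card ?F) \<le> real (card (private_sets ?R (U - {v}) B))"
      using fin by (simp add: card_mono finite_private_sets)
    also have "\<dots> \<le> weight (U - {v}) (B - {})"
      using bounded_belowD[OF IH, of "U - {v}" B] fin disj sub m cU by auto
    also have "\<dots> \<le> weight U B"
      using weight_diff[of U B "{v}" "{}"] fin v pos by simp
    finally show ?thesis .
  next
    case False
    then have "0 < card S + card P" using SP by (auto simp: card_gt_0_iff)
    note factor = undecided_factor_le[OF this]
    have "{D \<in> ?F. v \<in> D} = {D \<in> ?F. v \<in> D \<and> D \<inter> (S \<union> P) = {}}"
    proof -
      have "D \<inter> (S \<union> P) = {}" if "D \<in> ?F" "v \<in> D" for D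
        using simplicial_chosen_excludes_neighbours[OF that v(2)] by (auto simp: S_def P_def)
      then show ?thesis by blast
    qed
    \<comment> \<open>All neighbours of \<open>v\<close> are unchosen and can be private only for
      \<open>v\<close>, so they leave both \<open>U\<close> and \<open>B\<close>.\<close>
    also have "card \<dots> \<le> card (private_sets ?R (U - insert v (S \<union> P)) (B - (S \<union> P)))"
      by (intro card_private_sets_chosen[OF fin(1)]) (auto simp: S_def P_def intro: arcs_swap)
    also have "U - insert v (S \<union> P) = U - insert v S" using disj SP by blast
    also have "B - (S \<union> P) = B - P" using disj SP by blast
    finally have "real (card {D \<in> ?F. v \<in> D}) \<le> real (card (private_sets ?R (U - insert v S) (B - P)))"
      by simp
    also have "\<dots> \<le> weight (U - insert v S) (B - P)"
    proof (rule bounded_belowD[OF IH])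
      have "card (U - insert v S) \<le> card (U - {v})" using fin by (intro card_mono) auto
      moreover have "card (B - P) \<le> card B" using fin by (simp add: card_mono)
      ultimately show "2 * card (U - insert v S) + card (B - P) < m" using m cU by linarith
    qed (use fin disj sub in auto)
    also have "\<dots> = weight U B * ((8/15) ^ Suc (card S) * (2/3) ^ card P)"
      using weight_diff[of U B "insert v S" P] fin SP v vS by simp
    finally have chosen: "real (card {D \<in> ?F. v \<in> D})
        \<le> weight U B * ((8/15) ^ Suc (card S) * (2/3) ^ card P)" .
    have "real (card {D \<in> ?F. v \<notin> D}) \<le> real (card (private_sets ?R (U - {v}) (insert v B)))"
      using notin fin by (simp add: card_mono finite_private_sets)
    also have "\<dots> \<le> weight (U - {v}) (insert v B)
        * rejected_factor (card {x \<in> U - {v}. (v, x) \<in> ?R})"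
    \<comment> \<open>The vertex just rejected is branched on immediately. Rejecting it has lowered
      the measure, so the same \<open>m\<close> serves.\<close>
    proof (rule card_private_sets_rejected_simplicial[OF IH])
      have "(U - {v}) \<union> insert v B = U \<union> B" using v by blast
      then show "simplicial ?R ((U - {v}) \<union> insert v B) v" using v by simp
      have "card (insert v B) = Suc (card B)" using vB fin by simp
      then show "2 * card (U - {v}) + card (insert v B) \<le> m" using m cU by linarith
    qed (use fin disj sub v in auto)
    also have "{x \<in> U - {v}. (v, x) \<in> ?R} = S" using vS by (auto simp: S_def)
    finally have rejected: "real (card {D \<in> ?F. v \<notin> D}) \<le> weight U B * (4/5 * rejected_factor (card S))"
      by (simp add: w_moved mult.assoc)
    have "real (card ?F) \<le> weight U B *
        ((8/15) ^ Suc (card S) * (2/3) ^ card P + 4/5 * rejected_factor (card S))"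
      using split chosen rejected by (simp add: distrib_left)
    also have "\<dots> \<le> weight U B" using mult_left_mono[OF factor pos] by simp
    finally show ?thesis .
  qed
qed

theorem card_private_sets_le_weight:
  assumes "finite U" "finite B" "U \<inter> B = {}" "U \<union> B \<subseteq> pverts G"
  shows "real (card (private_sets (parcs G) U B)) \<le> weight U B"
  using assms
proof (induction "2 * card U + card B" arbitrary: U B rule: less_induct)
  case less
  have IH: "bounded_below (2 * card U + card B)"
    unfolding bounded_below_def using less.hyps by blast
  show ?case
  proof (cases "U \<union> B = {}")
    case True
    then have "private_sets (parcs G) U B = {{}}" by (auto simp: private_sets_def)
    then show ?thesis using True by (simp add: weight_def)
  next
    case False
    then obtain v where v: "simplicial (parcs G) (U \<union> B) v"
      using chordal_simplicial[OF chordal sym irrefl, of "U \<union> B"] less.prems by blast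
    then consider "v \<in> U" | "v \<in> B" by (auto simp: simplicial_def)
    then show ?thesis
    proof cases
      case 1
      then show ?thesis
        using card_private_sets_undecided_simplicial[OF IH less.prems le_refl _ v] by blast
    next
      case 2
      then have "real (card (private_sets (parcs G) U B))
          \<le> weight U B * rejected_factor (card {x \<in> U. (v, x) \<in> parcs G})"
        using card_private_sets_rejected_simplicial[OF IH less.prems le_refl _ v] by blast
      also have "\<dots> \<le> weight U B * 1"
        using rejected_factor_le by (intro mult_left_mono) (auto simp: weight_def)
      finally show ?thesis by simp
    qed
  qed
qed

end

section \<open>Minimal Roman dominating functions\<close>

text \<open>For \<open>D\<close> inside the vertex set, the pointwise least Roman dominating
  function whose vertices of value 2 are exactly those of \<open>D\<close>.\<close>

definition rdf_of :: "'a pair_pre_digraph \<Rightarrow> 'a set \<Rightarrow> 'a \<Rightarrow> nat" where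
  "rdf_of G D = (\<lambda>v \<in> pverts G. if v \<in> D then 2 else if \<exists>u \<in> D. (v, u) \<in> parcs G then 0 else 1)"

lemma inj_on_rdf_of: "inj_on (rdf_of G) (Pow (pverts G))"
proof (rule inj_onI)
  fix D D' assume D: "D \<in> Pow (pverts G)" "D' \<in> Pow (pverts G)" and eq: "rdf_of G D = rdf_of G D'"
  have "E = {v \<in> pverts G. rdf_of G E v = 2}" if "E \<subseteq> pverts G" for E
    using that by (auto simp: rdf_of_def split: if_splits)
  then show "D = D'" using D eq by (metis PowD)
qed

lemma minimal_rdfD:
  assumes "minimal_rdf G f" "rdf G g" "\<And>v. v \<in> pverts G \<Longrightarrow> g v \<le> f v"
  shows "g = f"
  using assms unfolding minimal_rdf_def by blast

text \<open>Two ways of lowering \<open>f\<close> are excluded. A vertex of value 2 without private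
  neighbour could get 1, since every vertex of value 0 next to it has another neighbour of value 2.
  A vertex of value 1 next to \<open>D\<close> could get 0.\<close>

lemma minimal_rdf_two_set:
  assumes min: "minimal_rdf G f"
  defines "D \<equiv> {v \<in> pverts G. f v = 2}"
  shows "D \<in> private_sets (parcs G) (pverts G) {}" "f = rdf_of G D"
proof -
  have f: "f \<in> pverts G \<rightarrow>\<^sub>E {0, 1, 2}"
    and dom: "\<And>v. v \<in> pverts G \<Longrightarrow> f v = 0 \<Longrightarrow> \<exists>u \<in> pverts G. (v, u) \<in> parcs G \<and> f u = 2"
    using min by (auto simp: minimal_rdf_def rdf_def)
  show "D \<in> private_sets (parcs G) (pverts G) {}"
    unfolding private_sets_def
  proof (intro CollectI conjI ballI)
    show "D \<subseteq> pverts G" by (auto simp: D_def)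
    fix v assume v: "v \<in> D"
    show "\<exists>w \<in> pverts G \<union> {}. w \<notin> D \<and> (w, v) \<in> parcs G \<and> (\<forall>u \<in> D. (w, u) \<in> parcs G \<longrightarrow> u = v)"
    proof (rule ccontr)
      assume no: "\<not> ?thesis"
      have "rdf G (f(v := 1))"
        unfolding rdf_def
      proof (intro conjI ballI impI)
        show "f(v := 1) \<in> pverts G \<rightarrow>\<^sub>E {0, 1, 2}"
          using f v by (auto simp: D_def PiE_iff extensional_def)
        fix w assume w: "w \<in> pverts G" "(f(v := 1)) w = 0"
        then have fw: "f w = 0" "w \<noteq> v" by (auto split: if_splits)
        obtain u where u: "u \<in> pverts G" "(w, u) \<in> parcs G" "f u = 2" using dom w fw by blast
        have "w \<notin> D" using fw by (simp add: D_def)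
        have "\<exists>u' \<in> D. (w, u') \<in> parcs G \<and> u' \<noteq> v"
        proof (cases "u = v")
          case True
          then show ?thesis using no w u \<open>w \<notin> D\<close> by blast
        next
          case False
          then show ?thesis using u by (auto simp: D_def)
        qed
        then show "\<exists>u \<in> pverts G. (w, u) \<in> parcs G \<and> (f(v := 1)) u = 2"
          by (auto simp: D_def)
      qed
      then have "f(v := 1) = f"
        by (rule minimal_rdfD[OF min]) (use v in \<open>auto simp: D_def\<close>)
      then have "f v = 1" by (metis fun_upd_same)
      then show False using v by (simp add: D_def)
    qed
  qed
  have one: "(v, u) \<notin> parcs G" if v: "v \<in> pverts G" "f v = 1" and u: "u \<in> D" for v u
  proof
    assume vu: "(v, u) \<in> parcs G"
    have "rdf G (f(v := 0))"
      unfolding rdf_def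
    proof (intro conjI ballI impI)
      show "f(v := 0) \<in> pverts G \<rightarrow>\<^sub>E {0, 1, 2}"
        using f v by (auto simp: PiE_iff extensional_def)
      fix w assume w: "w \<in> pverts G" "(f(v := 0)) w = 0"
      have "\<exists>x \<in> pverts G. (w, x) \<in> parcs G \<and> f x = 2"
      proof (cases "w = v")
        case True
        then show ?thesis using vu u by (auto simp: D_def)
      next
        case False
        then show ?thesis using w dom by auto
      qed
      then obtain x where "x \<in> pverts G" "(w, x) \<in> parcs G" "f x = 2" by blast
      moreover have "x \<noteq> v" using v \<open>f x = 2\<close> by auto
      ultimately show "\<exists>x \<in> pverts G. (w, x) \<in> parcs G \<and> (f(v := 0)) x = 2"
        by auto
    qed
    then have "f(v := 0) = f"
      by (rule minimal_rdfD[OF min]) auto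
    then have "f v = 0" by (metis fun_upd_same)
    then show False using v by simp
  qed
  show "f = rdf_of G D"
  proof
    fix v
    show "f v = rdf_of G D v"
    proof (cases "v \<in> pverts G")
      case True
      have "f v \<in> {0, 1, 2}" using PiE_mem[OF f True] .
      then show ?thesis using True dom[OF True] one[OF True] by (auto simp: rdf_of_def D_def)
    next
      case False
      then show ?thesis using f by (auto simp: rdf_of_def PiE_iff extensional_def)
    qed
  qed
qed

text \<open>A smaller \<open>g\<close> has its values 2 inside \<open>D\<close>. The private
  neighbour of \<open>v\<close> in \<open>D\<close> has value 0 also under \<open>g\<close>, and
  only \<open>v\<close> can dominate it, so \<open>g v = 2\<close>. A vertex of value 1 has no
  neighbour in \<open>D\<close> and hence cannot drop to 0.\<close>

lemma minimal_rdf_rdf_of: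
  assumes D: "D \<in> private_sets (parcs G) (pverts G) {}"
  shows "minimal_rdf G (rdf_of G D)"
proof -
  let ?f = "rdf_of G D"
  have sub: "D \<subseteq> pverts G" using D by (simp add: private_sets_def)
  have two: "?f v = 2 \<longleftrightarrow> v \<in> D" if "v \<in> pverts G" for v
    using that by (simp add: rdf_of_def)
  have zero: "?f v = 0 \<longleftrightarrow> v \<notin> D \<and> (\<exists>u \<in> D. (v, u) \<in> parcs G)" if "v \<in> pverts G" for v
    using that by (simp add: rdf_of_def)
  have "rdf G ?f"
    unfolding rdf_def
  proof (intro conjI ballI impI)
    show "?f \<in> pverts G \<rightarrow>\<^sub>E {0, 1, 2}" by (auto simp: rdf_of_def)
    fix v assume "v \<in> pverts G" "?f v = 0"
    then obtain u where "u \<in> D" "(v, u) \<in> parcs G" using zero by blast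
    then show "\<exists>u \<in> pverts G. (v, u) \<in> parcs G \<and> ?f u = 2"
      using sub two by blast
  qed
  moreover have "g = ?f" if g: "rdf G g" and le: "\<forall>v \<in> pverts G. g v \<le> ?f v" for g
  proof
    have gV: "g \<in> pverts G \<rightarrow>\<^sub>E {0, 1, 2}"
      and dom: "\<And>v. v \<in> pverts G \<Longrightarrow> g v = 0 \<Longrightarrow> \<exists>u \<in> pverts G. (v, u) \<in> parcs G \<and> g u = 2"
      using g by (auto simp: rdf_def)
    have f_le: "?f v \<le> 2" if "v \<in> pverts G" for v
      using that by (simp add: rdf_of_def)
    have in_D: "u \<in> D" if "u \<in> pverts G" "g u = 2" for u
      using le f_le two that by (metis le_antisym)
    fix v
    show "g v = ?f v"
    proof (cases "v \<in> pverts G")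
      case False
      then show ?thesis using gV by (auto simp: rdf_of_def PiE_iff extensional_def)
    next
      case True
      consider "v \<in> D" | "?f v = 0" | "v \<notin> D" "\<not> (\<exists>u \<in> D. (v, u) \<in> parcs G)"
        using zero[OF True] by (cases "v \<in> D") auto
      then show ?thesis
      proof cases
        case 1
        then obtain w where w: "w \<in> pverts G" "w \<notin> D" "(w, v) \<in> parcs G"
            "\<forall>u \<in> D. (w, u) \<in> parcs G \<longrightarrow> u = v"
          using D unfolding private_sets_def by blast
        then have "?f w = 0" using zero 1 by blast
        then have "g w = 0" using le w by (metis le_zero_eq)
        then obtain u where u: "u \<in> pverts G" "(w, u) \<in> parcs G" "g u = 2" using dom w by blast
        then have "u = v" using in_D w by blast
        then show ?thesis using u two True 1 by simp
      next
        case 2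
        then show ?thesis using le True by (metis le_zero_eq)
      next
        case 3
        have "g v \<noteq> 0" using dom[OF True] in_D 3 by blast
        moreover have "?f v = 1" using 3 True by (simp add: rdf_of_def)
        moreover have "g v \<le> ?f v" using le True by blast
        ultimately show ?thesis by linarith
      qed
    qed
  qed
  ultimately show ?thesis unfolding minimal_rdf_def by blast
qed

theorem minimal_rdf_eq_image:
  "{f. minimal_rdf G f} = rdf_of G ` private_sets (parcs G) (pverts G) {}"
  using minimal_rdf_two_set[of G] minimal_rdf_rdf_of[of _ G] by blast

section \<open>Resource bounds of programs\<close>

definition visible :: "(event \<times> mem) list \<Rightarrow> event list" where
  "visible tr = filter (\<lambda>e. e \<noteq> Silent) (map fst tr)"

lemma visible_simps [simp]:
  "visible [] = []"
  "visible ((Silent, s) # tr) = visible tr"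
  "visible ((Symbol k, s) # tr) = Symbol k # visible tr"
  "visible ((End, s) # tr) = End # visible tr"
  "visible (tr @ tr') = visible tr @ visible tr'"
  by (simp_all add: visible_def)

definition mem_bounded :: "nat \<Rightarrow> nat \<Rightarrow> mem \<Rightarrow> bool" where
  "mem_bounded m w s \<longleftrightarrow> (\<forall>a i. (m \<le> i \<longrightarrow> s a i = 0) \<and> s a i < w)"

lemma mem_bounded_store:
  "mem_bounded m w s \<Longrightarrow> i < m \<Longrightarrow> k < w \<Longrightarrow> mem_bounded m w (store a i k s)"
  by (auto simp: mem_bounded_def store_def)

lemma store_apply: "store a i k s b j = (if b = a \<and> j = i then k else s b j)"
  by (simp add: store_def)

lemma store_other: "b \<noteq> a \<Longrightarrow> store a i k s b = s b"
  by (simp add: store_def)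

text \<open>A frame condition: \<open>F\<close> lists the arrays that may have changed.\<close>

definition agree :: "nat set \<Rightarrow> mem \<Rightarrow> mem \<Rightarrow> bool" where
  "agree F s s' \<longleftrightarrow> (\<forall>a. a \<notin> F \<longrightarrow> s' a = s a)"

lemma agreeD: "agree F s s' \<Longrightarrow> a \<notin> F \<Longrightarrow> s' a = s a"
  by (simp add: agree_def)

lemma agree_refl: "agree F s s"
  by (simp add: agree_def)

lemma agree_trans: "agree F s s' \<Longrightarrow> agree F' s' s'' \<Longrightarrow> F \<subseteq> F'' \<Longrightarrow> F' \<subseteq> F'' \<Longrightarrow> agree F'' s s''"
  unfolding agree_def by (metis subsetD)

lemma agree_store: "agree F s s' \<Longrightarrow> a \<in> F \<Longrightarrow> agree F s (store a i k s')"
  by (auto simp: agree_def store_def)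

lemma concat_map_Nil: "concat (map (\<lambda>k. []) xs) = []"
  by (induction xs) auto

text \<open>A total correctness judgement for one initial memory. The time is only bounded, but the
  output is exact. Every intermediate memory is constrained, as \<open>space_at_most\<close>
  inspects all of them.\<close>

definition runs ::
    "nat \<Rightarrow> nat \<Rightarrow> nat \<Rightarrow> event list \<Rightarrow> (mem \<Rightarrow> bool) \<Rightarrow> com \<Rightarrow> mem \<Rightarrow> bool" where
  "runs m w t out Q c s \<longleftrightarrow> (\<exists>tr s'. exec c s tr s' \<and> length tr \<le> t \<and> visible tr = out \<and>
     (\<forall>x \<in> set tr. mem_bounded m w (snd x)) \<and> Q s')"

lemma runs_weaken:
  "runs m w t out P c s \<Longrightarrow> t \<le> t' \<Longrightarrow> (\<And>s'. P s' \<Longrightarrow> Q s') \<Longrightarrow> runs m w t' out Q c s"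
  unfolding runs_def using le_trans by fast

lemma runs_Skip: "mem_bounded m w s \<Longrightarrow> Q s \<Longrightarrow> runs m w 1 [] Q Skip s"
  unfolding runs_def by (intro exI[of _ "[(Silent, s)]"] exI[of _ s]) (simp add: exec.Skip)

lemma runs_Write:
  assumes "mem_bounded m w s" "val i s < m" "val e s < w" "Q (store a (val i s) (val e s) s)"
  shows "runs m w 1 [] Q (Write a i e) s"
  unfolding runs_def
  by (intro exI[of _ "[(Silent, store a (val i s) (val e s) s)]"] exI[of _ "store a (val i s) (val e s) s"])
    (use assms in \<open>auto intro: exec.Write mem_bounded_store\<close>)

lemma runs_Print: "mem_bounded m w s \<Longrightarrow> Q s \<Longrightarrow> runs m w 1 [Symbol (val e s)] Q (Print e) s"
  unfolding runs_def by (intro exI[of _ "[(Symbol (val e s), s)]"] exI[of _ s]) (simp add: exec.Print)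

lemma runs_EndOutput: "mem_bounded m w s \<Longrightarrow> Q s \<Longrightarrow> runs m w 1 [End] Q EndOutput s"
  unfolding runs_def by (intro exI[of _ "[(End, s)]"] exI[of _ s]) (simp add: exec.EndOutput)

lemma runs_Seq:
  assumes "runs m w t out P c s" "\<And>s'. P s' \<Longrightarrow> runs m w t' out' Q c' s'"
  shows "runs m w (t + t') (out @ out') Q (Seq c c') s"
proof -
  obtain tr s' where 1: "exec c s tr s'" "length tr \<le> t" "visible tr = out"
      "\<forall>x \<in> set tr. mem_bounded m w (snd x)" "P s'"
    using assms(1) unfolding runs_def by blast
  obtain tr' s'' where 2: "exec c' s' tr' s''" "length tr' \<le> t'" "visible tr' = out'"
      "\<forall>x \<in> set tr'. mem_bounded m w (snd x)" "Q s''"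
    using assms(2)[OF 1(5)] unfolding runs_def by blast
  have "exec (Seq c c') s (tr @ tr') s''" using 1(1) 2(1) by (rule exec.Seq)
  then show ?thesis
    unfolding runs_def using 1 2 by (intro exI[of _ "tr @ tr'"] exI[of _ s'']) auto
qed

lemma runs_Cond:
  assumes "mem_bounded m w s" "runs m w t out Q (if val b s \<noteq> 0 then c else c') s"
  shows "runs m w (Suc t) out Q (Cond b c c') s"
proof -
  obtain tr s' where 1: "exec (if val b s \<noteq> 0 then c else c') s tr s'" "length tr \<le> t" "visible tr = out"
      "\<forall>x \<in> set tr. mem_bounded m w (snd x)" "Q s'"
    using assms(2) unfolding runs_def by blast
  have "exec (Cond b c c') s ((Silent, s) # tr) s'"
    using 1(1) by (cases "val b s = 0") (auto intro: exec.CondTrue exec.CondFalse)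
  then show ?thesis
    unfolding runs_def using 1 assms(1) by (intro exI[of _ "(Silent, s) # tr"] exI[of _ s']) auto
qed

text \<open>The value of the guard is the number of remaining rounds and so doubles as the
  termination measure.\<close>

lemma runs_While_count:
  assumes inv: "\<And>k s. k \<le> n \<Longrightarrow> I k s \<Longrightarrow> mem_bounded m w s \<and> val b s = n - k"
    and body: "\<And>k s. k < n \<Longrightarrow> I k s \<Longrightarrow> runs m w t (out k) (I (Suc k)) c s"
  shows "I 0 s \<Longrightarrow> runs m w (n * Suc t + 1) (concat (map out [0..<n])) (I n) (While b c) s"
proof -
  have "runs m w ((n - k) * Suc t + 1) (concat (map out [k..<n])) (I n) (While b c) s"
    if "k \<le> n" "I k s" for k s
    using that
  proof (induction "n - k" arbitrary: k s)
    case 0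
    then have k: "k = n" by simp
    have "exec (While b c) s [(Silent, s)] s"
      using inv[of k s] 0 k by (intro exec.WhileFalse) simp
    then show ?case
      unfolding runs_def k using inv[of k s] 0 k
      by (intro exI[of _ "[(Silent, s)]"] exI[of _ s]) simp
  next
    case (Suc j)
    then have k: "k < n" by simp
    have val: "mem_bounded m w s" "val b s \<noteq> 0" using inv[of k s] Suc k by auto
    obtain tr s' where 1: "exec c s tr s'" "length tr \<le> t" "visible tr = out k"
        "\<forall>x \<in> set tr. mem_bounded m w (snd x)" "I (Suc k) s'"
      using body[OF k Suc.prems(2)] unfolding runs_def by blast
    have "j = n - Suc k" "Suc k \<le> n" using Suc k by auto
    then have "runs m w ((n - Suc k) * Suc t + 1) (concat (map out [Suc k..<n])) (I n) (While b c) s'"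
      using Suc.hyps(1) 1(5) by blast
    then obtain tr' s'' where 2: "exec (While b c) s' tr' s''" "length tr' \<le> (n - Suc k) * Suc t + 1"
        "visible tr' = concat (map out [Suc k..<n])"
        "\<forall>x \<in> set tr'. mem_bounded m w (snd x)" "I n s''"
      unfolding runs_def by blast
    have "exec (While b c) s ((Silent, s) # tr @ tr') s''"
      using val(2) 1(1) 2(1) by (rule exec.WhileTrue)
    moreover have "length ((Silent, s) # tr @ tr') \<le> (n - k) * Suc t + 1"
    proof -
      have "n - k = Suc (n - Suc k)" using k by simp
      then show ?thesis using 1(2) 2(2) by simp
    qed
    moreover have "visible ((Silent, s) # tr @ tr') = concat (map out [k..<n])"
      using 1(3) 2(3) k by (simp add: upt_conv_Cons)
    ultimately show ?case
      unfolding runs_def using 1 2 val(1)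
      by (intro exI[of _ "(Silent, s) # tr @ tr'"] exI[of _ s'']) auto
  qed
  from this[of 0] show "I 0 s \<Longrightarrow> runs m w (n * Suc t + 1) (concat (map out [0..<n])) (I n) (While b c) s"
    by simp
qed

section \<open>The enumeration algorithm\<close>

abbreviation var :: "nat \<Rightarrow> expr" where
  "var a \<equiv> Read a (Const 0)"

text \<open>All tests of the algorithm are counts of 0/1 terms, so one scheme serves the three
  nested loops, and an accumulator never exceeds \<open>n\<close>. The command \<open>c\<close> runs
  before \<open>e\<close> is evaluated, so that a summand can use the result of an inner
  loop.\<close>

definition sum_loop :: "nat \<Rightarrow> nat \<Rightarrow> com \<Rightarrow> expr \<Rightarrow> com" where
  "sum_loop i acc c e =
     Seq (Write i (Const 0) (Const 0)) (Seq (Write acc (Const 0) (Const 0))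
       (While (Sub (var 0) (var i))
         (Seq c (Seq (Write acc (Const 0) (Add (var acc) e))
           (Write i (Const 0) (Add (var i) (Const 1)))))))"

lemma sum_le_bound: "(\<And>k. k < n \<Longrightarrow> g k \<le> 1) \<Longrightarrow> j \<le> n \<Longrightarrow> (\<Sum>k<j. g k) \<le> (j::nat)"
  using sum_bounded_above[of "{..<j}" g 1] by auto

text \<open>Nesting works because \<open>F\<close>, the arrays changed by the inner command, avoids
  the counter, the accumulator and array 0. Each round costs a test and two writes besides
  \<open>c\<close>; the final 3 is for the two initial writes and the last test.\<close>

lemma runs_sum_loop:
  assumes s: "mem_bounded m w s" "s 0 0 = n" and mw: "0 < m" "n < w"
    and arrays: "i \<noteq> acc" "0 \<notin> insert i (insert acc F)" "i \<notin> F" "acc \<notin> F"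
    and body: "\<And>k s'. k < n \<Longrightarrow> mem_bounded m w s' \<Longrightarrow> agree (insert i (insert acc F)) s s' \<Longrightarrow>
      s' i 0 = k \<Longrightarrow>
      runs m w t [] (\<lambda>s''. mem_bounded m w s'' \<and> agree F s' s'' \<and> val e s'' = g k) c s'"
    and le1: "\<And>k. k < n \<Longrightarrow> g k \<le> 1"
  shows "runs m w (n * (t + 3) + 3) []
    (\<lambda>s'. mem_bounded m w s' \<and> agree (insert i (insert acc F)) s s' \<and> s' acc 0 = (\<Sum>k<n. g k))
    (sum_loop i acc c e) s"
proof -
  let ?F = "insert i (insert acc F)"
  define I where "I k s' \<longleftrightarrow> mem_bounded m w s' \<and> agree ?F s s' \<and> s' i 0 = k \<and> s' acc 0 = (\<Sum>j<k. g j)"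
    for k s'
  have I0: "I 0 (store acc 0 0 (store i 0 0 s))"
    using s mw arrays by (auto simp: I_def store_apply intro!: mem_bounded_store agree_store agree_refl)
  have "runs m w (n * Suc (t + 2) + 1) (concat (map (\<lambda>k. []) [0..<n])) (I n)
      (While (Sub (var 0) (var i))
         (Seq c (Seq (Write acc (Const 0) (Add (var acc) e)) (Write i (Const 0) (Add (var i) (Const 1))))))
      (store acc 0 0 (store i 0 0 s))"
  proof (rule runs_While_count[where I = I and out = "\<lambda>k. []", OF _ _ I0])
    fix k s' assume "k \<le> n" "I k s'"
    moreover have "s' 0 = s 0" using \<open>I k s'\<close> arrays by (intro agreeD[of ?F]) (auto simp: I_def)
    ultimately show "mem_bounded m w s' \<and> val (Sub (var 0) (var i)) s' = n - k"
      using s by (simp add: I_def)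
  next
    fix k s' assume k: "k < n" and I: "I k s'"
    have "runs m w (t + (1 + 1)) ([] @ [] @ []) (I (Suc k))
        (Seq c (Seq (Write acc (Const 0) (Add (var acc) e)) (Write i (Const 0) (Add (var i) (Const 1))))) s'"
    proof (rule runs_Seq)
      show "runs m w t [] (\<lambda>s''. mem_bounded m w s'' \<and> agree F s' s'' \<and> val e s'' = g k) c s'"
        using I k by (intro body) (auto simp: I_def)
      fix s2 assume s2: "mem_bounded m w s2 \<and> agree F s' s2 \<and> val e s2 = g k"
      have eq: "s2 acc = s' acc" "s2 i = s' i" using s2 arrays by (auto intro: agreeD)
      have ag: "agree ?F s s2" using I s2 by (auto simp: I_def intro: agree_trans)
      let ?s3 = "store acc 0 ((\<Sum>j<k. g j) + g k) s2"
      have sum: "(\<Sum>j<k. g j) + g k \<le> Suc k" using sum_le_bound[of n g "Suc k"] le1 k by simp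
      have b3: "mem_bounded m w ?s3" using s2 sum k mw by (intro mem_bounded_store) auto
      show "runs m w (1 + 1) ([] @ []) (I (Suc k))
          (Seq (Write acc (Const 0) (Add (var acc) e)) (Write i (Const 0) (Add (var i) (Const 1)))) s2"
      proof (rule runs_Seq)
        show "runs m w 1 [] (\<lambda>x. x = ?s3) (Write acc (Const 0) (Add (var acc) e)) s2"
          using s2 sum k mw I eq by (intro runs_Write) (auto simp: I_def)
        fix x assume x: "x = ?s3"
        show "runs m w 1 [] (I (Suc k)) (Write i (Const 0) (Add (var i) (Const 1))) x"
          using x b3 ag I eq arrays k mw
          by (intro runs_Write)
            (auto simp: I_def store_apply intro!: mem_bounded_store agree_store)
      qed
    qed
    then show "runs m w (t + 2) [] (I (Suc k))
        (Seq c (Seq (Write acc (Const 0) (Add (var acc) e)) (Write i (Const 0) (Add (var i) (Const 1))))) s'"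
      by simp
  qed
  then have loop: "runs m w (n * (t + 3) + 1) [] (I n)
      (While (Sub (var 0) (var i))
         (Seq c (Seq (Write acc (Const 0) (Add (var acc) e)) (Write i (Const 0) (Add (var i) (Const 1))))))
      (store acc 0 0 (store i 0 0 s))"
    by (simp add: concat_map_Nil numeral_3_eq_3)
  have "runs m w (1 + (1 + (n * (t + 3) + 1))) ([] @ [] @ []) (I n) (sum_loop i acc c e) s"
    unfolding sum_loop_def
  proof (rule runs_Seq[of _ _ _ _ "\<lambda>x. x = store i 0 0 s"])
    show "runs m w 1 [] (\<lambda>x. x = store i 0 0 s) (Write i (Const 0) (Const 0)) s"
      using s mw by (intro runs_Write) auto
    fix x assume x: "x = store i 0 0 s"
    show "runs m w (1 + (n * (t + 3) + 1)) ([] @ []) (I n) (Seq (Write acc (Const 0) (Const 0))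
       (While (Sub (var 0) (var i))
         (Seq c (Seq (Write acc (Const 0) (Add (var acc) e)) (Write i (Const 0) (Add (var i) (Const 1))))))) x"
    proof (rule runs_Seq[of _ _ _ _ "\<lambda>y. y = store acc 0 0 (store i 0 0 s)"])
      show "runs m w 1 [] (\<lambda>y. y = store acc 0 0 (store i 0 0 s)) (Write acc (Const 0) (Const 0)) x"
        using s mw x by (intro runs_Write) (auto intro: mem_bounded_store)
    qed (use loop in simp)
  qed
  then show ?thesis
    unfolding append_Nil by (rule runs_weaken) (auto simp: I_def)
qed

definition adj :: "nat \<Rightarrow> nat \<Rightarrow> expr" where
  "adj a b = Read 1 (Add (Mul (var a) (var 0)) (var b))"

text \<open>
  Array 2 holds the indicator function of the chosen set and array 3 the position in the backtracking
  search; the arrays 4 to 9 are loop counters and accumulators. With truncated subtraction,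
  \<open>1 - x\<close> tests for \<open>x = 0\<close> and \<open>1 - (x - 1)\<close> for \<open>x \<le> 1\<close>.
\<close>
definition count_chosen_nbrs :: com where
  "count_chosen_nbrs = sum_loop 7 6 Skip (Mul (Read 2 (var 7)) (adj 5 7))"

definition count_private_nbrs :: com where
  "count_private_nbrs = sum_loop 5 8 count_chosen_nbrs
     (Mul (Mul (Sub (Const 1) (Read 2 (var 5))) (adj 4 5)) (Sub (Const 1) (Sub (var 6) (Const 1))))"

definition count_violations :: com where
  "count_violations = sum_loop 4 9 count_private_nbrs (Mul (Read 2 (var 4)) (Sub (Const 1) (var 8)))"

definition print_rdf :: com where
  "print_rdf = Seq (Write 5 (Const 0) (Const 0))
     (While (Sub (var 0) (var 5))
       (Seq count_chosen_nbrs
         (Seq (Print (Add (Mul (Const 2) (Read 2 (var 5)))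
             (Mul (Sub (Const 1) (Read 2 (var 5))) (Sub (Const 1) (var 6)))))
           (Write 5 (Const 0) (Add (var 5) (Const 1))))))"

definition advance :: com where
  "advance = Seq (Write 2 (var 3) (Const 0)) (Write 3 (Const 0) (Add (var 3) (Const 1)))"

text \<open>One bit operation of the counter; below the current position all bits are 0. A bit 1 is
  cleared and the carry moves on. A bit 0 is set tentatively; if this leaves the family, the bit is
  cleared again and the carry moves on, which skips all sets with the same higher bits and this bit
  set, as they are supersets.\<close>

definition step :: com where
  "step = Cond (Read 2 (var 3)) advance
     (Seq (Write 2 (var 3) (Const 1)) (Seq count_violations
       (Cond (var 9) advance
         (Seq (Seq print_rdf EndOutput) (Write 3 (Const 0) (Const 0))))))"

text \<open>The empty set is always in the family and is output before the loop. Position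
  \<open>n\<close> means that the counter has overflowed.\<close>

definition enumerate_rdfs :: com where
  "enumerate_rdfs = Seq (Seq print_rdf EndOutput) (While (Sub (var 0) (var 3)) step)"

section \<open>Correctness of the tests and of the printing\<close>

locale enumeration =
  fixes n :: nat and G :: "nat pair_pre_digraph"
  assumes verts: "pverts G = {0..<n}" and arcs_sym: "sym (parcs G)"
begin

text \<open>The matrix takes \<open>n * n\<close> cells; the summand 1 provides cell 0 for the
  scalar variables even if \<open>n = 0\<close>. Counts and positions are at most
  \<open>n\<close>.\<close>

abbreviation cells :: nat where "cells \<equiv> n * n + n + 1"
abbreviation word :: nat where "word \<equiv> n + 2"
abbreviation "ok \<equiv> mem_bounded cells word"
abbreviation "run \<equiv> runs cells word"
abbreviation "family \<equiv> private_sets (parcs G) {0..<n} {}"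

definition input :: "nat set \<Rightarrow> mem \<Rightarrow> bool" where
  "input D s \<longleftrightarrow> ok s \<and> s 0 0 = n \<and> s 1 = graph_input n G 1 \<and> s 2 = (\<lambda>i. of_bool (i \<in> D))"

lemma graph_input_adj:
  assumes "u < n" "v < n"
  shows "graph_input n G 1 (u * n + v) = of_bool ((u, v) \<in> parcs G)"
proof -
  have "u * n + v < Suc u * n" using assms by simp
  also have "\<dots> \<le> n * n" using assms by (intro mult_right_mono) auto
  finally show ?thesis using assms by (simp add: graph_input_def)
qed

lemma input_agree:
  assumes "input D s" "agree F s s'" "F \<inter> {0, 1, 2} = {}" "ok s'"
  shows "input D s'"
proof -
  have "0 \<notin> F" "1 \<notin> F" "2 \<notin> F" using assms(3) by auto
  then have "s' 0 = s 0" "s' 1 = s 1" "s' 2 = s 2" using assms(2) agreeD by blast+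
  then show ?thesis using assms(1,4) by (simp add: input_def)
qed

definition nbrs :: "nat set \<Rightarrow> nat \<Rightarrow> nat" where
  "nbrs D v = card {u \<in> D. (v, u) \<in> parcs G}"

lemma sum_of_bool_nbrs:
  assumes "D \<subseteq> {..<n}"
  shows "(\<Sum>u<n. of_bool (u \<in> D) * of_bool ((v, u) \<in> parcs G)) = nbrs D v"
proof -
  have "(\<Sum>u<n. of_bool (u \<in> D) * of_bool ((v, u) \<in> parcs G))
      = (\<Sum>u<n. of_bool (u \<in> D \<and> (v, u) \<in> parcs G) :: nat)"
    by (intro sum.cong) auto
  also have "\<dots> = card ({..<n} \<inter> {u. u \<in> D \<and> (v, u) \<in> parcs G})"
    by (simp add: of_bool_def sum.If_cases)
  also have "{..<n} \<inter> {u. u \<in> D \<and> (v, u) \<in> parcs G} = {u \<in> D. (v, u) \<in> parcs G}"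
    using assms by auto
  finally show ?thesis by (simp add: nbrs_def)
qed

lemma run_count_chosen_nbrs:
  assumes s: "input D s" and D: "D \<subseteq> {..<n}" and v: "s 5 0 = v" "v < n"
  shows "run (n * 4 + 3) [] (\<lambda>s'. ok s' \<and> agree {6, 7} s s' \<and> s' 6 0 = nbrs D v) count_chosen_nbrs s"
proof -
  have "run (n * (1 + 3) + 3) []
      (\<lambda>s'. ok s' \<and> agree {7, 6} s s' \<and> s' 6 0 = (\<Sum>u<n. of_bool (u \<in> D) * of_bool ((v, u) \<in> parcs G)))
      count_chosen_nbrs s"
    unfolding count_chosen_nbrs_def
  proof (rule runs_sum_loop)
    fix u s' assume u: "u < n" "ok s'" "agree {7, 6} s s'" "s' 7 0 = u"
    then have "input D s'" using input_agree[OF s u(3)] by simp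
    moreover have "s' 5 0 = v" using u v by (simp add: agree_def)
    ultimately have "val (Mul (Read 2 (var 7)) (adj 5 7)) s'
        = of_bool (u \<in> D) * of_bool ((v, u) \<in> parcs G)"
      using u v graph_input_adj[of v u] by (simp add: input_def adj_def)
    with u show "run 1 [] (\<lambda>s''. ok s'' \<and> agree {} s' s'' \<and>
        val (Mul (Read 2 (var 7)) (adj 5 7)) s'' = of_bool (u \<in> D) * of_bool ((v, u) \<in> parcs G)) Skip s'"
      by (intro runs_Skip) (simp_all add: agree_refl)
  qed (use s in \<open>auto simp: input_def\<close>)
  then show ?thesis
    unfolding sum_of_bool_nbrs[OF D] by (simp add: insert_commute)
qed

definition privates :: "nat set \<Rightarrow> nat \<Rightarrow> nat" where
  "privates D v = (\<Sum>w<n. (1 - of_bool (w \<in> D)) * of_bool ((v, w) \<in> parcs G) * (1 - (nbrs D w - 1)))"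

lemma run_count_private_nbrs:
  assumes s: "input D s" and D: "D \<subseteq> {..<n}" and v: "s 4 0 = v" "v < n"
  shows "run (n * (n * 4 + 6) + 3) [] (\<lambda>s'. ok s' \<and> agree {5, 6, 7, 8} s s' \<and> s' 8 0 = privates D v)
    count_private_nbrs s"
proof -
  let ?e = "Mul (Mul (Sub (Const 1) (Read 2 (var 5))) (adj 4 5)) (Sub (Const 1) (Sub (var 6) (Const 1)))"
  have "run (n * ((n * 4 + 3) + 3) + 3) []
      (\<lambda>s'. ok s' \<and> agree (insert 5 (insert 8 {6, 7})) s s' \<and> s' 8 0 = privates D v)
      count_private_nbrs s"
    unfolding count_private_nbrs_def privates_def
  proof (rule runs_sum_loop)
    fix w s' assume w: "w < n" "ok s'" "agree {5, 8, 6, 7} s s'" "s' 5 0 = w"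
    have i: "input D s'" using input_agree[OF s w(3)] w by simp
    have v': "s' 4 0 = v" using w v by (simp add: agree_def)
    show "run (n * 4 + 3) [] (\<lambda>s''. ok s'' \<and> agree {6, 7} s' s'' \<and> val ?e s'' =
        (1 - of_bool (w \<in> D)) * of_bool ((v, w) \<in> parcs G) * (1 - (nbrs D w - 1))) count_chosen_nbrs s'"
    proof (rule runs_weaken[OF run_count_chosen_nbrs[OF i D w(4) w(1)]])
      fix s'' assume s'': "ok s'' \<and> agree {6, 7} s' s'' \<and> s'' 6 0 = nbrs D w"
      then have "input D s''" using input_agree[OF i, of "{6, 7}" s''] by simp
      moreover have "s'' 5 0 = w" "s'' 4 0 = v" using s'' w v' by (simp_all add: agree_def)
      ultimately show "ok s'' \<and> agree {6, 7} s' s'' \<and> val ?e s'' =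
          (1 - of_bool (w \<in> D)) * of_bool ((v, w) \<in> parcs G) * (1 - (nbrs D w - 1))"
        using s'' w v graph_input_adj[of v w] by (simp add: input_def adj_def)
    qed simp
  qed (use s in \<open>auto simp: input_def\<close>)
  moreover have "insert 5 (insert 8 {6, 7}) = {5, 6, 7, 8 :: nat}" by auto
  ultimately show ?thesis by (simp add: add.assoc)
qed

definition violations :: "nat set \<Rightarrow> nat" where
  "violations D = (\<Sum>v<n. of_bool (v \<in> D) * (1 - privates D v))"

lemma run_count_violations:
  assumes s: "input D s" and D: "D \<subseteq> {..<n}"
  shows "run (n * (n * (n * 4 + 6) + 6) + 3) []
    (\<lambda>s'. ok s' \<and> agree {4, 5, 6, 7, 8, 9} s s' \<and> s' 9 0 = violations D) count_violations s"
proof -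
  let ?e = "Mul (Read 2 (var 4)) (Sub (Const 1) (var 8))"
  have "run (n * ((n * (n * 4 + 6) + 3) + 3) + 3) []
      (\<lambda>s'. ok s' \<and> agree (insert 4 (insert 9 {5, 6, 7, 8})) s s' \<and> s' 9 0 = violations D)
      count_violations s"
    unfolding count_violations_def violations_def
  proof (rule runs_sum_loop)
    fix v s' assume v: "v < n" "ok s'" "agree {4, 9, 5, 6, 7, 8} s s'" "s' 4 0 = v"
    have i: "input D s'" using input_agree[OF s v(3)] v by simp
    show "run (n * (n * 4 + 6) + 3) [] (\<lambda>s''. ok s'' \<and> agree {5, 6, 7, 8} s' s'' \<and> val ?e s'' =
        of_bool (v \<in> D) * (1 - privates D v)) count_private_nbrs s'"
    proof (rule runs_weaken[OF run_count_private_nbrs[OF i D v(4) v(1)]])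
      fix s'' assume s'': "ok s'' \<and> agree {5, 6, 7, 8} s' s'' \<and> s'' 8 0 = privates D v"
      then have "input D s''" using input_agree[OF i, of "{5, 6, 7, 8}" s''] by simp
      moreover have "s'' 4 0 = v" using s'' v by (simp add: agree_def)
      ultimately show "ok s'' \<and> agree {5, 6, 7, 8} s' s'' \<and> val ?e s'' = of_bool (v \<in> D) * (1 - privates D v)"
        using s'' by (simp add: input_def)
    qed simp
  qed (use s in \<open>auto simp: input_def\<close>)
  moreover have "insert 4 (insert 9 {5, 6, 7, 8}) = {4, 5, 6, 7, 8, 9 :: nat}" by auto
  ultimately show ?thesis by (simp add: add.assoc)
qed

lemma violations_eq_0_iff:
  assumes D: "D \<subseteq> {..<n}"
  shows "violations D = 0 \<longleftrightarrow> D \<in> family"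
proof -
  have finD: "finite D" using D finite_subset by blast
  have priv: "privates D v \<noteq> 0 \<longleftrightarrow>
      (\<exists>w \<in> {0..<n}. w \<notin> D \<and> (w, v) \<in> parcs G \<and> (\<forall>u \<in> D. (w, u) \<in> parcs G \<longrightarrow> u = v))"
    if "v \<in> D" for v
  proof -
    have "(1 - of_bool (w \<in> D)) * of_bool ((v, w) \<in> parcs G) * (1 - (nbrs D w - 1)) \<noteq> (0::nat) \<longleftrightarrow>
        w \<notin> D \<and> (w, v) \<in> parcs G \<and> (\<forall>u \<in> D. (w, u) \<in> parcs G \<longrightarrow> u = v)" for w
    proof -
      have "(v, w) \<in> parcs G \<longleftrightarrow> (w, v) \<in> parcs G" using arcs_sym by (meson symD)
      \<comment> \<open>Since \<open>v\<close> is itself a chosen neighbour of \<open>w\<close>,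
        having at most one means having no other. This spares the program a comparison of
        vertices.\<close>
      moreover have "nbrs D w \<le> 1 \<longleftrightarrow> (\<forall>u \<in> D. (w, u) \<in> parcs G \<longrightarrow> u = v)" if wv: "(w, v) \<in> parcs G"
      proof -
        have "nbrs D w \<le> 1 \<longleftrightarrow> (\<forall>x \<in> {u \<in> D. (w, u) \<in> parcs G}. \<forall>y \<in> {u \<in> D. (w, u) \<in> parcs G}. x = y)"
          unfolding nbrs_def using finD by (simp add: card_le_Suc0_iff_eq)
        then show ?thesis using \<open>v \<in> D\<close> wv by blast
      qed
      moreover have "(1 - of_bool (w \<in> D)) * of_bool ((v, w) \<in> parcs G) * (1 - (nbrs D w - 1)) \<noteq> (0::nat) \<longleftrightarrow>
          w \<notin> D \<and> (v, w) \<in> parcs G \<and> nbrs D w \<le> 1"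
        by auto
      ultimately show ?thesis by metis
    qed
    then show ?thesis unfolding privates_def by (auto simp: sum_eq_0_iff)
  qed
  have "violations D = 0 \<longleftrightarrow> (\<forall>v \<in> D. privates D v \<noteq> 0)"
    unfolding violations_def using D by (auto simp: sum_eq_0_iff Suc_le_eq)
  also have "\<dots> \<longleftrightarrow> D \<in> family"
    using D priv by (auto simp: private_sets_def atLeast0LessThan)
  finally show ?thesis .
qed

lemma run_print_rdf:
  assumes s: "input D s" and D: "D \<subseteq> {..<n}"
  shows "run (n * (n * 4 + 6) + 2) (map (\<lambda>v. Symbol (rdf_of G D v)) [0..<n])
    (\<lambda>s'. ok s' \<and> agree {5, 6, 7} s s') print_rdf s"
proof -
  let ?F = "{5, 6, 7} :: nat set"
  let ?p = "Add (Mul (Const 2) (Read 2 (var 5))) (Mul (Sub (Const 1) (Read 2 (var 5))) (Sub (Const 1) (var 6)))"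
  let ?w = "While (Sub (var 0) (var 5)) (Seq count_chosen_nbrs (Seq (Print ?p) (Write 5 (Const 0) (Add (var 5) (Const 1)))))"
  define I where "I k s' \<longleftrightarrow> ok s' \<and> agree ?F s s' \<and> s' 5 0 = k" for k s'
  have I0: "I 0 (store 5 0 0 s)"
    using s by (auto simp: I_def input_def store_apply intro!: mem_bounded_store agree_store agree_refl)
  have inp: "input D s'" if "I k s'" for k s'
    using input_agree[OF s, of ?F s'] that by (simp add: I_def)
  have "run (n * Suc (n * 4 + 5) + 1) (concat (map (\<lambda>v. [Symbol (rdf_of G D v)]) [0..<n])) (I n) ?w (store 5 0 0 s)"
  proof (rule runs_While_count[where I = I and out = "\<lambda>v. [Symbol (rdf_of G D v)]", OF _ _ I0])
    fix k s' assume "k \<le> n" "I k s'"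
    then show "ok s' \<and> val (Sub (var 0) (var 5)) s' = n - k"
      using inp[of k s'] by (simp add: I_def input_def)
  next
    fix v s' assume v: "v < n" and I: "I v s'"
    have "run ((n * 4 + 3) + (1 + 1)) ([] @ [Symbol (rdf_of G D v)] @ []) (I (Suc v))
        (Seq count_chosen_nbrs (Seq (Print ?p) (Write 5 (Const 0) (Add (var 5) (Const 1))))) s'"
    proof (rule runs_Seq)
      show "run (n * 4 + 3) [] (\<lambda>s''. ok s'' \<and> agree {6, 7} s' s'' \<and> s'' 6 0 = nbrs D v) count_chosen_nbrs s'"
        using I v by (intro run_count_chosen_nbrs[OF inp[OF I] D]) (auto simp: I_def)
      fix s2 assume s2: "ok s2 \<and> agree {6, 7} s' s2 \<and> s2 6 0 = nbrs D v"
      have i2: "input D s2" using input_agree[OF inp[OF I], of "{6, 7}" s2] s2 by simp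
      have v2: "s2 5 0 = v" using s2 I by (simp add: I_def agree_def)
      have ag: "agree ?F s s2" using I s2 by (auto simp: I_def intro: agree_trans)
      have "finite D" using D finite_subset by blast
      then have "nbrs D v = 0 \<longleftrightarrow> \<not> (\<exists>u \<in> D. (v, u) \<in> parcs G)" by (auto simp: nbrs_def)
      then have "val ?p s2 = rdf_of G D v"
        using i2 v2 s2 v verts by (auto simp: input_def rdf_of_def Suc_le_eq)
      moreover have "run (1 + 1) ([Symbol (val ?p s2)] @ []) (I (Suc v))
          (Seq (Print ?p) (Write 5 (Const 0) (Add (var 5) (Const 1)))) s2"
      proof (rule runs_Seq)
        show "run 1 [Symbol (val ?p s2)] (\<lambda>x. x = s2) (Print ?p) s2"
          using s2 by (intro runs_Print) auto
        fix x assume x: "x = s2"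
        show "run 1 [] (I (Suc v)) (Write 5 (Const 0) (Add (var 5) (Const 1))) x"
          using x s2 v2 v ag
          by (intro runs_Write) (auto simp: I_def store_apply intro!: mem_bounded_store agree_store)
      qed
      ultimately show "run (1 + 1) ([Symbol (rdf_of G D v)] @ []) (I (Suc v))
          (Seq (Print ?p) (Write 5 (Const 0) (Add (var 5) (Const 1)))) s2"
        by simp
    qed
    then show "run (n * 4 + 5) [Symbol (rdf_of G D v)] (I (Suc v))
        (Seq count_chosen_nbrs (Seq (Print ?p) (Write 5 (Const 0) (Add (var 5) (Const 1))))) s'"
      by (simp add: add.commute)
  qed
  moreover have "concat (map (\<lambda>v. [Symbol (rdf_of G D v)]) xs) = map (\<lambda>v. Symbol (rdf_of G D v)) xs" for xs
    by (induction xs) auto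
  ultimately have loop: "run (n * (n * 4 + 6) + 1) (map (\<lambda>v. Symbol (rdf_of G D v)) [0..<n]) (I n) ?w (store 5 0 0 s)"
    by (simp add: add.commute)
  have "run (1 + (n * (n * 4 + 6) + 1)) ([] @ map (\<lambda>v. Symbol (rdf_of G D v)) [0..<n]) (I n) print_rdf s"
    unfolding print_rdf_def
  proof (rule runs_Seq[of _ _ _ _ "\<lambda>x. x = store 5 0 0 s"])
    show "run 1 [] (\<lambda>x. x = store 5 0 0 s) (Write 5 (Const 0) (Const 0)) s"
      using s by (intro runs_Write) (auto simp: input_def)
  qed (use loop in simp)
  then have "run (n * (n * 4 + 6) + 2) (map (\<lambda>v. Symbol (rdf_of G D v)) [0..<n]) (I n) print_rdf s"
    by (simp add: add.commute)
  then show ?thesis by (rule runs_weaken) (auto simp: I_def)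
qed

end

section \<open>Delay\<close>

text \<open>\<open>delay_at_most\<close> speaks about arbitrary stretches and does not split along
  \<open>@\<close>. A running count of the steps since the last \<open>End\<close>, together with
  its final value, does.\<close>

primrec gap_after :: "nat \<Rightarrow> (event \<times> mem) list \<Rightarrow> nat" where
  "gap_after a [] = a"
| "gap_after a (x # tr) = gap_after (if fst x = End then 0 else Suc a) tr"

primrec gaps_le :: "nat \<Rightarrow> nat \<Rightarrow> (event \<times> mem) list \<Rightarrow> bool" where
  "gaps_le d a [] \<longleftrightarrow> a \<le> d"
| "gaps_le d a (x # tr) \<longleftrightarrow> a \<le> d \<and> gaps_le d (if fst x = End then 0 else Suc a) tr"

lemma gap_after_append: "gap_after a (tr @ tr') = gap_after (gap_after a tr) tr'"
  by (induction tr arbitrary: a) auto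

lemma gaps_le_start: "gaps_le d a tr \<Longrightarrow> a \<le> d"
  by (cases tr) auto

lemma gaps_le_append: "gaps_le d a (tr @ tr') \<longleftrightarrow> gaps_le d a tr \<and> gaps_le d (gap_after a tr) tr'"
  by (induction tr arbitrary: a) (auto dest: gaps_le_start)

lemma gap_after_le: "gap_after a tr \<le> a + length tr"
proof (induction tr arbitrary: a)
  case (Cons x tr)
  show ?case using Cons[of 0] Cons[of "Suc a"] by simp
qed simp

lemma gap_after_End: "End \<in> fst ` set tr \<Longrightarrow> gap_after a tr \<le> length tr"
proof (induction tr arbitrary: a)
  case (Cons x tr)
  then show ?case using gap_after_le[of 0 tr] Cons.IH[of "Suc a"] by (auto intro: le_SucI)
qed simp

lemma gap_after_no_End: "End \<notin> fst ` set tr \<Longrightarrow> gap_after a tr = a + length tr"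
  by (induction tr arbitrary: a) auto

lemma gaps_le_short: "a + length tr \<le> d \<Longrightarrow> gaps_le d a tr"
  by (induction tr arbitrary: a) auto

lemma gaps_le_delay:
  assumes "gaps_le d a tr"
  shows "delay_at_most d tr"
  unfolding delay_at_most_def
proof (intro allI impI)
  fix xs ys zs assume "tr = xs @ ys @ zs \<and> End \<notin> fst ` set ys"
  then have "gaps_le d (gap_after a xs + length ys) zs"
    using assms by (simp add: gaps_le_append gap_after_append gap_after_no_End)
  then show "length ys \<le> d" using gaps_le_start by fastforce
qed

text \<open>Each \<open>End\<close> closes a stretch of at most \<open>d\<close> other steps, and
  one more stretch follows the last. This turns the delay into a bound on the total time.\<close>

lemma gaps_le_length:
  "gaps_le d a tr \<Longrightarrow> a + length tr \<le> (count_list (visible tr) End + 1) * (d + 1)"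
proof (induction tr arbitrary: a)
  case (Cons x tr)
  obtain e s where x: "x = (e, s)" by fastforce
  show ?case
  proof (cases e)
    case End
    then have "length tr \<le> (count_list (visible tr) End + 1) * (d + 1)" "a \<le> d"
      using Cons x by force+
    then show ?thesis using x End by simp
  qed (use Cons.IH[of "Suc a"] Cons.prems x in simp_all)
qed simp

text \<open>\<open>exec\<close> describes only loops that have finished; composing the search from
  phases needs unfinished sequences of rounds.\<close>

inductive iterates :: "expr \<Rightarrow> com \<Rightarrow> mem \<Rightarrow> (event \<times> mem) list \<Rightarrow> mem \<Rightarrow> bool" for b c where
  iterates_refl: "iterates b c s [] s"
| iterates_step: "val b s \<noteq> 0 \<Longrightarrow> exec c s tr s' \<Longrightarrow> iterates b c s' tr' s'' \<Longrightarrow>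
    iterates b c s ((Silent, s) # tr @ tr') s''"

lemma iterates_trans: "iterates b c s tr s' \<Longrightarrow> iterates b c s' tr' s'' \<Longrightarrow> iterates b c s (tr @ tr') s''"
proof (induction rule: iterates.induct)
  case (iterates_step s tr s' tr'' s''')
  from iterates.iterates_step[OF iterates_step.hyps(1,2) iterates_step.IH[OF iterates_step.prems]]
  show ?case by simp
qed simp

lemma exec_While_iterates:
  "iterates b c s tr s' \<Longrightarrow> val b s' = 0 \<Longrightarrow> exec (While b c) s (tr @ [(Silent, s')]) s'"
proof (induction rule: iterates.induct)
  case (iterates_refl s)
  then show ?case by (simp add: exec.WhileFalse)
next
  case (iterates_step s tr s' tr' s'')
  from exec.WhileTrue[OF iterates_step.hyps(1,2) iterates_step.IH[OF iterates_step.prems]]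
  show ?case by simp
qed

section \<open>The backtracking search\<close>

context enumeration
begin

definition config :: "nat set \<Rightarrow> nat \<Rightarrow> mem \<Rightarrow> bool" where
  "config D j s \<longleftrightarrow> input D s \<and> s 3 0 = j"

lemma config_ok: "config D j s \<Longrightarrow> ok s"
  by (simp add: config_def input_def)

lemma config_agree:
  assumes "config D j s" "agree F s s'" "F \<inter> {0, 1, 2, 3} = {}" "ok s'"
  shows "config D j s'"
proof -
  have "3 \<notin> F" "F \<inter> {0, 1, 2} = {}" using assms(3) by auto
  then show ?thesis using assms input_agree agreeD[of F s s' 3] by (auto simp: config_def)
qed

lemma run_set_chosen:
  assumes s: "config D j s" and j: "j < n" and k: "k = 0 \<and> D' = D - {j} \<or> k = 1 \<and> D' = insert j D"
  shows "run 1 [] (config D' j) (Write 2 (var 3) (Const k)) s"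
proof (rule runs_Write)
  show "ok s" using s by (rule config_ok)
  have val: "val (var 3) s = j" using s by (simp add: config_def)
  show "val (var 3) s < cells" "val (Const k) s < word" using val j k by auto
  have "ok (store 2 j k s)" using \<open>ok s\<close> j k by (intro mem_bounded_store) auto
  moreover have "store 2 j k s 2 = (\<lambda>i. of_bool (i \<in> D'))"
    using s k by (auto simp: config_def input_def store_apply)
  ultimately have "config D' j (store 2 j k s)"
    using s by (simp add: config_def input_def store_other)
  then show "config D' j (store 2 (val (var 3) s) (val (Const k) s) s)" using val by simp
qed

lemma run_set_position:
  assumes s: "config D j s" and e: "val e s = i" "i \<le> n"
  shows "run 1 [] (config D i) (Write 3 (Const 0) e) s"
proof (rule runs_Write)
  show ok: "ok s" using s by (rule config_ok)
  show "val (Const 0) s < cells" "val e s < word" using e by auto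
  have "ok (store 3 0 i s)" using ok e by (intro mem_bounded_store) auto
  then show "config D i (store 3 (val (Const 0) s) (val e s) s)"
    using s e by (simp add: config_def input_def store_other store_apply)
qed

lemma run_advance:
  assumes "config D j s" "j < n"
  shows "run 2 [] (config (D - {j}) (Suc j)) advance s"
proof -
  have "run (1 + 1) ([] @ []) (config (D - {j}) (Suc j)) advance s"
    unfolding advance_def
  proof (rule runs_Seq[OF run_set_chosen[OF assms]])
    fix s' assume s': "config (D - {j}) j s'"
    show "run 1 [] (config (D - {j}) (Suc j)) (Write 3 (Const 0) (Add (var 3) (Const 1))) s'"
      by (rule run_set_position[OF s']) (use s' assms in \<open>auto simp: config_def\<close>)
  qed simp
  then show ?thesis by (simp add: numeral_2_eq_2)
qed

definition output_of :: "nat set \<Rightarrow> event list" where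
  "output_of D = map (\<lambda>v. Symbol (rdf_of G D v)) [0..<n] @ [End]"

lemma run_print_End:
  assumes "config D j s" "D \<subseteq> {..<n}"
  shows "run (n * (n * 4 + 6) + 3) (output_of D) (config D j) (Seq print_rdf EndOutput) s"
proof -
  have "run ((n * (n * 4 + 6) + 2) + 1) (output_of D) (config D j) (Seq print_rdf EndOutput) s"
    unfolding output_of_def
  proof (rule runs_Seq)
    show "run (n * (n * 4 + 6) + 2) (map (\<lambda>v. Symbol (rdf_of G D v)) [0..<n]) (config D j) print_rdf s"
    proof (rule runs_weaken[OF run_print_rdf])
      show "input D s" using assms by (simp add: config_def)
      show "config D j s'" if "ok s' \<and> agree {5, 6, 7} s s'" for s'
        using config_agree[OF assms(1), of "{5, 6, 7}" s'] that by simp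
    qed (use assms in simp_all)
    show "run 1 [End] (config D j) EndOutput s'" if "config D j s'" for s'
      using that config_ok by (intro runs_EndOutput)
  qed
  then show ?thesis by (rule runs_weaken) auto
qed

text \<open>One check and one printing; 20 generously covers the constant overhead.\<close>

definition step_time :: nat where
  "step_time = n * (n * (n * 4 + 6) + 6) + n * (n * 4 + 6) + 20"

lemma run_step_remove:
  assumes s: "config D j s" and j: "j < n" "j \<in> D"
  shows "run step_time [] (config (D - {j}) (Suc j)) step s"
proof -
  have "run (Suc 2) [] (config (D - {j}) (Suc j)) step s"
    unfolding step_def
  proof (rule runs_Cond)
    show "ok s" using s by (rule config_ok)
    have val: "val (Read 2 (var 3)) s \<noteq> 0" using s j by (simp add: config_def input_def)
    show "run 2 [] (config (D - {j}) (Suc j)) (if val (Read 2 (var 3)) s \<noteq> 0 then advance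
        else Seq (Write 2 (var 3) (Const 1)) (Seq count_violations (Cond (var 9) advance
          (Seq (Seq print_rdf EndOutput) (Write 3 (Const 0) (Const 0)))))) s"
      by (subst if_P[OF val]) (rule run_advance[OF s j(1)])
  qed
  then show ?thesis by (rule runs_weaken) (auto simp: step_time_def)
qed

lemma run_step_add:
  assumes s: "config D j s" and j: "j < n" "j \<notin> D" and D: "D \<subseteq> {..<n}"
  defines "succ \<equiv> insert j D \<in> family"
  shows "run step_time (if succ then output_of (insert j D) else [])
    (if succ then config (insert j D) 0 else config D (Suc j)) step s"
proof -
  let ?D = "insert j D"
  let ?Q = "if succ then config ?D 0 else config D (Suc j)" and ?out = "if succ then output_of ?D else []"
  let ?print = "Seq (Seq print_rdf EndOutput) (Write 3 (Const 0) (Const 0))"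
  let ?t1 = "n * (n * (n * 4 + 6) + 6) + 3" and ?t2 = "n * (n * 4 + 6) + 3"
  have D': "?D \<subseteq> {..<n}" using j D by auto
  have inner: "run (Suc (?t2 + 2)) ?out ?Q (Cond (var 9) advance ?print) s'"
    if s': "config ?D j s'" "s' 9 0 = violations ?D" for s'
  proof (rule runs_Cond)
    show "ok s'" using s' config_ok by blast
    have val: "val (var 9) s' \<noteq> 0 \<longleftrightarrow> \<not> succ"
      using s' violations_eq_0_iff[OF D'] by (simp add: succ_def)
    show "run (?t2 + 2) ?out ?Q (if val (var 9) s' \<noteq> 0 then advance else ?print) s'"
    proof (cases succ)
      case True
      have "run (?t2 + 1) (output_of ?D @ []) (config ?D 0) ?print s'"
      proof (rule runs_Seq[OF run_print_End[OF s'(1) D']])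
        show "run 1 [] (config ?D 0) (Write 3 (Const 0) (Const 0)) s2" if "config ?D j s2" for s2
          by (rule run_set_position[OF that]) auto
      qed
      then show ?thesis using True val by (auto intro: runs_weaken)
    next
      case False
      have "?D - {j} = D" using j by auto
      then have "run 2 [] (config D (Suc j)) advance s'" using run_advance[OF s'(1) j(1)] by simp
      then show ?thesis using False val by (auto intro: runs_weaken)
    qed
  qed
  have "run (Suc (1 + (?t1 + Suc (?t2 + 2)))) ([] @ [] @ ?out) ?Q step s"
    unfolding step_def
  proof (rule runs_Cond)
    show "ok s" using s by (rule config_ok)
    have "val (Read 2 (var 3)) s = 0" using s j by (simp add: config_def input_def)
    moreover have "run (1 + (?t1 + Suc (?t2 + 2))) ([] @ [] @ ?out) ?Q
        (Seq (Write 2 (var 3) (Const 1)) (Seq count_violations (Cond (var 9) advance ?print))) s"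
    proof (rule runs_Seq)
      show "run 1 [] (config ?D j) (Write 2 (var 3) (Const 1)) s"
        by (rule run_set_chosen[OF s j(1)]) simp
      fix s1 assume s1: "config ?D j s1"
      show "run (?t1 + Suc (?t2 + 2)) ([] @ ?out) ?Q
          (Seq count_violations (Cond (var 9) advance ?print)) s1"
      proof (rule runs_Seq)
        show "run ?t1 [] (\<lambda>s'. config ?D j s' \<and> s' 9 0 = violations ?D) count_violations s1"
        proof (rule runs_weaken[OF run_count_violations])
          show "input ?D s1" using s1 by (simp add: config_def)
          show "config ?D j s'' \<and> s'' 9 0 = violations ?D"
            if "ok s'' \<and> agree {4, 5, 6, 7, 8, 9} s1 s'' \<and> s'' 9 0 = violations ?D" for s''
            using config_agree[OF s1, of "{4, 5, 6, 7, 8, 9}" s''] that by simp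
        qed (use D' in simp_all)
      qed (use inner in blast)
    qed
    ultimately show "run (1 + (?t1 + Suc (?t2 + 2))) ([] @ [] @ ?out) ?Q
        (if val (Read 2 (var 3)) s \<noteq> 0 then advance
         else Seq (Write 2 (var 3) (Const 1)) (Seq count_violations (Cond (var 9) advance ?print))) s"
      by simp
  qed
  then show ?thesis
    unfolding append_Nil by (rule runs_weaken) (auto simp: step_time_def)
qed

abbreviation "guard \<equiv> Sub (var 0) (var 3)"
abbreviation "lap \<equiv> Suc step_time"
text \<open>After an output the position restarts at 0, and each step without output raises it by
  one. So there is a lap for the rest of the step that made the output, up to \<open>n\<close> laps
  for such steps, and one for the step in progress.\<close>

abbreviation "delay \<equiv> lap * (n + 2)"

text \<open>
  \<open>a\<close> and \<open>b\<close> bound the time that has passed since the last completed output_of, before and after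
  the iterations.
\<close>
definition progress :: "nat \<Rightarrow> event list \<Rightarrow> nat \<Rightarrow> (mem \<Rightarrow> bool) \<Rightarrow> mem \<Rightarrow> bool" where
  "progress a out b Q s \<longleftrightarrow> (\<exists>tr s'. iterates guard step s tr s' \<and> visible tr = out \<and>
     (\<forall>x \<in> set tr. ok (snd x)) \<and> (\<forall>a' \<le> a. gaps_le delay a' tr \<and> gap_after a' tr \<le> b) \<and> Q s')"

lemma progress_refl: "a \<le> delay \<Longrightarrow> Q s \<Longrightarrow> progress a [] a Q s"
  unfolding progress_def by (intro exI[of _ "[]"] exI[of _ s]) (simp add: iterates_refl)

lemma progress_trans:
  assumes "progress a out b P s" "\<And>s'. P s' \<Longrightarrow> progress b out' c Q s'"
  shows "progress a (out @ out') c Q s"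
proof -
  obtain tr s' where 1: "iterates guard step s tr s'" "visible tr = out" "\<forall>x \<in> set tr. ok (snd x)"
      "\<forall>a' \<le> a. gaps_le delay a' tr \<and> gap_after a' tr \<le> b" "P s'"
    using assms(1) unfolding progress_def by blast
  obtain tr' s'' where 2: "iterates guard step s' tr' s''" "visible tr' = out'" "\<forall>x \<in> set tr'. ok (snd x)"
      "\<forall>a' \<le> b. gaps_le delay a' tr' \<and> gap_after a' tr' \<le> c" "Q s''"
    using assms(2)[OF 1(5)] unfolding progress_def by blast
  show ?thesis
    unfolding progress_def
    using iterates_trans[OF 1(1) 2(1)] 1 2
    by (intro exI[of _ "tr @ tr'"] exI[of _ s'']) (auto simp: gaps_le_append gap_after_append)
qed

lemma progress_step:
  assumes r: "run step_time out Q step s" and s: "config D j s" "j < n" and a: "a + lap \<le> delay"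
  shows "progress a out (if End \<in> set out then lap else a + lap) Q s"
proof -
  obtain tr s' where 1: "exec step s tr s'" "length tr \<le> step_time" "visible tr = out"
      "\<forall>x \<in> set tr. ok (snd x)" "Q s'"
    using r unfolding runs_def by blast
  have "val guard s \<noteq> 0" using s by (simp add: config_def input_def)
  then have it: "iterates guard step s ((Silent, s) # tr @ []) s'"
    using 1(1) by (rule iterates_step) (rule iterates_refl)
  let ?tr = "(Silent, s) # tr"
  have len: "length ?tr \<le> lap" using 1 by simp
  have "gaps_le delay a' ?tr \<and> gap_after a' ?tr \<le> (if End \<in> set out then lap else a + lap)"
    if "a' \<le> a" for a'
  proof
    show "gaps_le delay a' ?tr" using that len a by (intro gaps_le_short) linarith
    show "gap_after a' ?tr \<le> (if End \<in> set out then lap else a + lap)"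
    proof (cases "End \<in> set out")
      case True
      then have "End \<in> fst ` set ?tr" using 1(3) by (auto simp: visible_def)
      then show ?thesis using gap_after_End[of ?tr a'] len True by (simp del: gap_after.simps)
    next
      case False
      then show ?thesis using gap_after_le[of a' ?tr] len that by (simp del: gap_after.simps)
    qed
  qed
  then show ?thesis
    unfolding progress_def using it 1 config_ok[OF s(1)]
    by (intro exI[of _ ?tr] exI[of _ s']) (auto simp del: gap_after.simps gaps_le.simps)
qed

text \<open>
  The sets that are output between the first and the last visit of \<open>D\<close> with position \<open>0\<close> and \<open>j\<close>,
  respectively.
\<close>
primrec later :: "nat \<Rightarrow> nat set \<Rightarrow> nat set list" where
  "later 0 D = []"
| "later (Suc j) D = later j D @
     (if insert j D \<in> family then insert j D # later j (insert j D) else [])"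

text \<open>The sets are split by whether they contain \<open>j\<close>. If
  \<open>insert j D\<close> is not in the family, then by heredity no set above it is, so skipping
  loses nothing.\<close>

lemma set_later:
  "D \<in> family \<Longrightarrow> set (D # later j D) = {X \<in> family. D \<subseteq> X \<and> X - D \<subseteq> {..<j}}"
proof (induction j arbitrary: D)
  case 0
  then show ?case by auto
next
  case (Suc j)
  have split: "{X \<in> family. D \<subseteq> X \<and> X - D \<subseteq> {..<Suc j}} =
      {X \<in> family. D \<subseteq> X \<and> X - D \<subseteq> {..<j}} \<union> {X \<in> family. insert j D \<subseteq> X \<and> X - insert j D \<subseteq> {..<j}}"
    by (auto simp: less_Suc_eq)
  show ?case
  proof (cases "insert j D \<in> family")
    case True
    then show ?thesis unfolding split using Suc.IH[OF Suc.prems] Suc.IH[OF True] by auto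
  next
    case False
    then have "{X \<in> family. insert j D \<subseteq> X \<and> X - insert j D \<subseteq> {..<j}} = {}"
      using private_sets_hereditary by blast
    then show ?thesis unfolding split using Suc.IH[OF Suc.prems] False by auto
  qed
qed

text \<open>The two halves of the recursion are told apart by \<open>j\<close>.\<close>

lemma distinct_later:
  "D \<in> family \<Longrightarrow> D \<inter> {..<j} = {} \<Longrightarrow> distinct (D # later j D)"
proof (induction j arbitrary: D)
  case 0
  then show ?case by simp
next
  case (Suc j)
  have disj: "D \<inter> {..<j} = {}" "j \<notin> D" using Suc.prems by auto
  have IH: "distinct (D # later j D)" using Suc.IH[OF Suc.prems(1) disj(1)] .
  show ?case
  proof (cases "insert j D \<in> family")
    case True
    have "distinct (insert j D # later j (insert j D))"
      using Suc.IH[OF True] disj by auto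
    moreover have "set (D # later j D) \<inter> set (insert j D # later j (insert j D)) = {}"
      unfolding set_later[OF True] set_later[OF Suc.prems(1)] using disj by auto
    ultimately have "distinct ((D # later j D) @ (insert j D # later j (insert j D)))"
      using IH unfolding distinct_append by blast
    then show ?thesis using True by simp
  next
    case False
    then show ?thesis using IH by simp
  qed
qed

lemma lap_mult_le_delay: "j \<le> n \<Longrightarrow> lap * (j + 1) + lap \<le> delay"
  using mult_le_mono2[of "j + 2" "n + 2" lap] by (simp add: algebra_simps)

lemma End_in_output_of: "End \<in> set (output_of D)"
  by (simp add: output_of_def)

text \<open>While the bits from \<open>j\<close> on are fixed, the lower bits run through all
  admissible patterns and end at all 0 with the carry at \<open>j\<close>. For \<open>Suc j\<close>
  this happens once without \<open>j\<close> and, if \<open>insert j D\<close> is admissible, once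
  more with it, before \<open>j\<close> is cleared. The output of \<open>insert j D\<close> resets
  the gap to one lap, so the second run starts under the same bound as the first.\<close>

lemma progress_later:
  "j \<le> n \<Longrightarrow> D \<subseteq> {j..<n} \<Longrightarrow> D \<in> family \<Longrightarrow> config D 0 s \<Longrightarrow>
    progress lap (concat (map output_of (later j D))) (lap * (j + 1)) (config D j) s"
proof (induction j arbitrary: D s)
  case 0
  then show ?case using progress_refl[of lap "config D 0" s] by simp
next
  case (Suc j)
  have jn: "j < n" "j \<le> n" "j \<notin> D" and D: "D \<subseteq> {j..<n}" "D \<subseteq> {..<n}" using Suc.prems by auto
  note bound = lap_mult_le_delay[OF jn(2)]
  have eq: "lap * (j + 1) + lap = lap * (Suc j + 1)" by (simp add: algebra_simps)
  have first: "progress lap (concat (map output_of (later j D))) (lap * (j + 1)) (config D j) s"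
    using Suc.IH[OF jn(2) D(1) Suc.prems(3,4)] .
  show ?case
  proof (cases "insert j D \<in> family")
    case False
    have "progress (lap * (j + 1)) [] (lap * (Suc j + 1)) (config D (Suc j)) s'" if "config D j s'" for s'
      using progress_step[OF run_step_add[OF that jn(1,3) D(2)] that jn(1) bound]
      by (simp only: False eq if_False list.set empty_iff)
    from progress_trans[OF first this] show ?thesis using False by simp
  next
    case True
    let ?D = "insert j D"
    have add: "progress (lap * (j + 1)) (output_of ?D) lap (config ?D 0) s'" if "config D j s'" for s'
      using progress_step[OF run_step_add[OF that jn(1,3) D(2)] that jn(1) bound] True End_in_output_of
      by simp
    have "?D \<subseteq> {j..<n}" using D jn by auto
    note second = Suc.IH[OF jn(2) this True]
    have remove: "progress (lap * (j + 1)) [] (lap * (Suc j + 1)) (config D (Suc j)) s'" if "config ?D j s'" for s'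
    proof -
      have "?D - {j} = D" using jn by auto
      then show ?thesis
        using progress_step[OF run_step_remove[OF that jn(1) insertI1] that jn(1) bound]
        by (simp only: eq if_False list.set empty_iff)
    qed
    from progress_trans[OF first progress_trans[OF add progress_trans[OF second remove]]]
    show ?thesis using True by simp
  qed
qed

lemma empty_in_family: "{} \<in> family"
  by (simp add: private_sets_def)

lemma ok_graph_input: "ok (graph_input n G)"
  by (auto simp: mem_bounded_def graph_input_def)

lemma config_graph_input: "config {} 0 (graph_input n G)"
  using ok_graph_input by (auto simp: config_def input_def graph_input_def)

lemma exec_enumerate_rdfs:
  obtains tr s' where "exec enumerate_rdfs (graph_input n G) tr s'"
    "visible tr = concat (map output_of ({} # later n {}))"
    "\<forall>x \<in> set tr. ok (snd x)" "gaps_le delay 0 tr"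
proof -
  have "run (n * (n * 4 + 6) + 3) (output_of {}) (config {} 0) (Seq print_rdf EndOutput) (graph_input n G)"
    using run_print_End[OF config_graph_input] by simp
  then obtain tr s where 1: "exec (Seq print_rdf EndOutput) (graph_input n G) tr s"
      "length tr \<le> n * (n * 4 + 6) + 3" "visible tr = output_of {}"
      "\<forall>x \<in> set tr. ok (snd x)" "config {} 0 s"
    unfolding runs_def by blast
  have len: "length tr \<le> lap" using 1(2) by (simp add: step_time_def)
  obtain tr' s' where 2: "iterates guard step s tr' s'" "visible tr' = concat (map output_of (later n {}))"
      "\<forall>x \<in> set tr'. ok (snd x)"
      "\<forall>a \<le> lap. gaps_le delay a tr' \<and> gap_after a tr' \<le> lap * (n + 1)" "config {} n s'"
    using progress_later[OF le_refl _ empty_in_family 1(5)] unfolding progress_def by blast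
  have "val guard s' = 0" using 2(5) by (simp add: config_def input_def)
  from exec_While_iterates[OF 2(1) this]
  have "exec enumerate_rdfs (graph_input n G) (tr @ tr' @ [(Silent, s')]) s'"
    unfolding enumerate_rdfs_def using 1(1) by (intro exec.Seq)
  moreover have "visible (tr @ tr' @ [(Silent, s')]) = concat (map output_of ({} # later n {}))"
    using 1 2 by simp
  moreover have "\<forall>x \<in> set (tr @ tr' @ [(Silent, s')]). ok (snd x)"
    using 1 2 config_ok by auto
  moreover have "gaps_le delay 0 (tr @ tr' @ [(Silent, s')])"
  proof -
    have "lap \<le> delay" using lap_mult_le_delay[of 0] by simp
    then have g1: "gaps_le delay 0 tr" using len by (intro gaps_le_short) simp
    have "gap_after 0 tr \<le> lap" using gap_after_le[of 0 tr] len by simp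
    then have g2: "gaps_le delay (gap_after 0 tr) tr'" "gap_after (gap_after 0 tr) tr' \<le> lap * (n + 1)"
      using 2(4) by auto
    have "lap * (n + 1) + 1 \<le> delay" using lap_mult_le_delay[of n] by simp
    then have "gaps_le delay (gap_after (gap_after 0 tr) tr') [(Silent, s')]"
      using g2 by (intro gaps_le_short) simp
    then show ?thesis using g1 g2 by (simp only: gaps_le_append)
  qed
  ultimately show thesis by (rule that)
qed

theorem enumerate_rdfs_correct:
  "\<exists>tr s'. exec enumerate_rdfs (graph_input n G) tr s' \<and>
     enumerates n tr {f. minimal_rdf G f} \<and> delay_at_most delay tr \<and>
     space_at_most cells word (graph_input n G) tr \<and>
     time tr \<le> (card family + 1) * (delay + 1)"
proof -
  obtain tr s' where tr: "exec enumerate_rdfs (graph_input n G) tr s'"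
    "visible tr = concat (map output_of ({} # later n {}))"
    "\<forall>x \<in> set tr. ok (snd x)" "gaps_le delay 0 tr"
    by (rule exec_enumerate_rdfs)
  let ?Ds = "{} # later n {}"
  have dist: "distinct ?Ds" by (rule distinct_later[OF empty_in_family]) simp
  have sub: "X \<subseteq> {..<n}" if "X \<in> family" for X
    using that by (simp add: private_sets_def atLeast0LessThan)
  have set: "set ?Ds = family"
    unfolding set_later[OF empty_in_family] using sub by auto
  let ?fs = "map (rdf_of G) ?Ds"
  have "inj_on (rdf_of G) (set ?Ds)"
    using sub verts unfolding set by (intro inj_on_subset[OF inj_on_rdf_of]) (auto simp: atLeast0LessThan)
  then have "distinct ?fs" using dist unfolding distinct_map by blast
  moreover have "set ?fs = {f. minimal_rdf G f}"
    using set minimal_rdf_eq_image[of G] verts by (simp only: set_map)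
  moreover have "filter (\<lambda>e. e \<noteq> Silent) (map fst tr)
      = concat (map (\<lambda>f. map (\<lambda>v. Symbol (f v)) [0..<n] @ [End]) ?fs)"
    using tr(2) unfolding visible_def by (simp add: output_of_def[abs_def] comp_def)
  ultimately have "enumerates n tr {f. minimal_rdf G f}"
    unfolding enumerates_def by blast
  moreover have "\<forall>t \<in> insert (graph_input n G) (snd ` set tr). ok t"
    using tr(3) ok_graph_input by auto
  then have "space_at_most cells word (graph_input n G) tr"
    unfolding space_at_most_def mem_bounded_def .
  moreover have "time tr \<le> (card family + 1) * (delay + 1)"
  proof -
    have "count_list (output_of D) End = 1" for D
      by (simp add: output_of_def count_list_0_iff image_iff)
    then have count: "count_list (concat (map output_of Ds)) End = length Ds" for Ds
      by (induction Ds) auto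
    have "card family = length ?Ds" unfolding set[symmetric] by (rule distinct_card[OF dist])
    then have "count_list (visible tr) End = card family" unfolding tr(2) count by (rule sym)
    then show ?thesis
      using gaps_le_length[OF tr(4)] by (simp only: time_def add_0)
  qed
  ultimately show ?thesis using tr(1) gaps_le_delay[OF tr(4)] by blast
qed

end

section \<open>The final bounds\<close>

definition delay_poly :: "nat poly" where
  "delay_poly = [:21, 12, 10, 4:] * [:2, 1:]"

text \<open>The floor bounds the number of outputs; the added 1 accounts for the stretch after the
  last one.\<close>

definition time_bound :: "nat \<Rightarrow> nat" where
  "time_bound n = (nat \<lfloor>(15/8 :: real) ^ n\<rfloor> + 1) * (poly delay_poly n + 1)"

lemma time_bound_bigo: "(\<lambda>n. real (time_bound n)) \<in> O(\<lambda>n. (1.8940 :: real) ^ n)"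
proof (rule landau_o.big_trans)
  let ?g = "\<lambda>n. ((15/8 :: real) ^ n + 1) *
    ((21 + 12 * real n + 10 * real n ^ 2 + 4 * real n ^ 3) * (2 + real n) + 1)"
  have "real (time_bound n) \<le> ?g n" for n
  proof -
    have "real (poly delay_poly n + 1) = (21 + 12 * real n + 10 * real n ^ 2 + 4 * real n ^ 3) * (2 + real n) + 1"
      by (simp add: delay_poly_def algebra_simps power2_eq_square power3_eq_cube)
    moreover have "real (nat \<lfloor>(15/8 :: real) ^ n\<rfloor> + 1) \<le> (15/8) ^ n + 1"
      by simp
    ultimately show ?thesis
      unfolding time_bound_def of_nat_mult by (intro mult_mono) auto
  qed
  then show "(\<lambda>n. real (time_bound n)) \<in> O(?g)"
    by (intro bigoI[of _ 1]) (auto intro: order_trans[OF _ abs_ge_self])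
  show "?g \<in> O(\<lambda>n. (1.8940 :: real) ^ n)"
    by real_asymp
qed

theorem theorem6:
  shows "\<exists>(A :: com) (delay :: nat poly) (cells :: nat poly) (word :: nat poly) (T :: nat \<Rightarrow> nat).
    (\<lambda>n. real (T n)) \<in> O(\<lambda>n. (1.8940 :: real) ^ n) \<and>
    (\<forall>(n :: nat) (G :: nat pair_pre_digraph).
       pair_graph G \<and> pverts G = {0..<n} \<and> chordal G \<longrightarrow>
       (\<exists>tr s'. exec A (graph_input n G) tr s' \<and>
          enumerates n tr {f. minimal_rdf G f} \<and>
          delay_at_most (poly delay n) tr \<and>
          space_at_most (poly cells n) (poly word n) (graph_input n G) tr \<and>
          time tr \<le> T n))"
proof (rule exI[of _ enumerate_rdfs], rule exI[of _ delay_poly], rule exI[of _ "[:1, 1, 1:]"],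
    rule exI[of _ "[:2, 1:]"], rule exI[of _ time_bound], intro conjI allI impI)
  show "(\<lambda>n. real (time_bound n)) \<in> O(\<lambda>n. (1.8940 :: real) ^ n)" by (rule time_bound_bigo)
  fix n :: nat and G :: "nat pair_pre_digraph"
  assume G: "pair_graph G \<and> pverts G = {0..<n} \<and> chordal G"
  then interpret pair_graph G by blast
  have sym: "sym (parcs G)" using pair_sym_arcs by (simp add: symmetric_def)
  have irrefl: "irrefl (parcs G)" using pair_no_loops by (fastforce simp: irrefl_def)
  interpret enumeration n G using G sym by unfold_locales auto
  interpret C: chordal_graph G using G sym irrefl by unfold_locales auto
  \<comment> \<open>The cubic factor of \<open>delay_poly\<close> is \<open>lap\<close>, the linear
    one \<open>n + 2\<close>.\<close>
  have delay: "poly delay_poly n = delay"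
    by (simp add: delay_poly_def step_time_def algebra_simps)
  have cells: "poly [:1, 1, 1:] n = cells" and word: "poly [:2, 1:] n = word"
    by (simp_all add: algebra_simps)
  have "real (card family) \<le> (15/8) ^ n"
    using C.card_private_sets_le_weight[of "{0..<n}" "{}"] G by (simp add: weight_def)
  then have "card family \<le> nat \<lfloor>(15/8 :: real) ^ n\<rfloor>" by linarith
  then have "(card family + 1) * (delay + 1) \<le> time_bound n"
    unfolding time_bound_def delay by (intro mult_right_mono) auto
  then show "\<exists>tr s'. exec enumerate_rdfs (graph_input n G) tr s' \<and>
      enumerates n tr {f. minimal_rdf G f} \<and> delay_at_most (poly delay_poly n) tr \<and>
      space_at_most (poly [:1, 1, 1:] n) (poly [:2, 1:] n) (graph_input n G) tr \<and>
      time tr \<le> time_bound n"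
    unfolding delay cells word using enumerate_rdfs_correct by (meson order_trans)
qed

end
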